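(* Let $N\ge1$. Suppose that for all $1\le i,j\le N+1$ the matrix-valued functions $A_{ij}(U),B_{ij}(U)\in\mathbb{R}^{2\times2}$ satisfy the rotational invariance for $2\times2$ matrices, i.e. $$T_2(\theta)^{-1}A_{ij}(T(\theta)U)\,T_2(\theta)=\cos\theta\,A_{ij}(U)+\sin\theta\,B_{ij}(U)$$ for every $0\le\theta<2\pi$ and every state $U$. Then the $(2N+3)\times(2N+3)$ matrices $$A(U)=A_H(U)+\begin{pmatrix}0&0\\0&(A_{ij}(U))_{1\le i,j\le N+1}\end{pmatrix},\qquad B(U)=B_H(U)+\begin{pmatrix}0&0\\0&(B_{ij}(U))_{1\le i,j\le N+1}\end{pmatrix}$$ (in which the first row and first column of the added matrices vanish, and the remaining $(2N+2)\times(2N+2)$ part is the block matrix with blocks $A_{ij}$, respectively $B_{ij}$), where $A_H,B_H$ are the coefficient matrices of the hyperbolic shallow water moment equations (HSWME) defined in the context, satisfy the rotational invariance $$\cos\theta\,A(U)+\sin\theta\,B(U)=T(\theta)^{-1}A(T(\theta)U)\,T(\theta)$$ for every $0\le\theta<2\pi$ and every state $U$.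
   Context: State vector: $U=(h,hu_m,hv_m,h\alpha_1,h\beta_1,\dots,h\alpha_N,h\beta_N)^T\in\mathbb{R}^{2N+3}$ with $h>0$; $g>0$ is a constant. $h,u_m,v_m,\alpha_i,\beta_i$ are regarded as functions of $U$. Rotation matrix: $T(\theta)=\mathrm{diag}(1,T_2(\theta),\dots,T_2(\theta))\in\mathbb{R}^{(2N+3)\times(2N+3)}$ with $T_2(\theta)=\begin{pmatrix}\cos\theta&\sin\theta\\-\sin\theta&\cos\theta\end{pmatrix}$. Definition of $A_H,B_H$. Let $\phi_j$ be the Legendre polynomial of degree $j$ shifted to $[0,1]$ (orthogonal on $[0,1]$) and normalized by $\phi_j(0)=1$. For $1\le i,j,k\le N$ put $a_{ijk}=(2i+1)\int_0^1\phi_i\phi_j\phi_k\,d\zeta$ and $b_{ijk}=(2i+1)\int_0^1\phi_i'(\zeta)\left(\int_0^\zeta\phi_j\,d\hat\zeta\right)\phi_k(\zeta)\,d\zeta$. Let $A^{SW}(U)=\partial_UF(U)+P(U)$ and $B^{SW}(U)=\partial_UG(U)+Q(U)$ ($\partial_U$ = Jacobian), where: the components of $F(U)$, in the same order as those of $U$, are $hu_m$; $h(u_m^2+\sum_{j=1}^N\frac{\alpha_j^2}{2j+1})+\frac12gh^2$; $h(u_mv_m+\sum_{j=1}^N\frac{\alpha_j\beta_j}{2j+1})$; and, for $i=1,\dots,N$, the pair $h(2u_m\alpha_i+\sum_{j,k=1}^Na_{ijk}\alpha_j\alpha_k)$, $h(u_m\beta_i+v_m\alpha_i+\sum_{j,k=1}^Na_{ijk}\alpha_j\beta_k)$;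 the components of $G(U)$ are $hv_m$; $h(u_mv_m+\sum_j\frac{\alpha_j\beta_j}{2j+1})$; $h(v_m^2+\sum_j\frac{\beta_j^2}{2j+1})+\frac12gh^2$; and, for $i=1,\dots,N$, the pair $h(u_m\beta_i+v_m\alpha_i+\sum_{j,k}a_{ijk}\alpha_j\beta_k)$, $h(2v_m\beta_i+\sum_{j,k}a_{ijk}\beta_j\beta_k)$; the first three rows and columns of $P(U),Q(U)$ vanish, and the remaining $2N\times2N$ parts have $2\times2$ blocks ($1\le i,j\le N$, $\delta_{ij}$ the Kronecker delta) $$P_{ij}=\begin{pmatrix}-\delta_{ij}u_m+\sum_kb_{ijk}\alpha_k&0\\-\delta_{ij}v_m+\sum_kb_{ijk}\beta_k&0\end{pmatrix},\qquad Q_{ij}=\begin{pmatrix}0&-\delta_{ij}u_m+\sum_kb_{ijk}\alpha_k\\0&-\delta_{ij}v_m+\sum_kb_{ijk}\beta_k\end{pmatrix}.$$ Then $A_H(U)=A^{SW}(h,hu_m,hv_m,h\alpha_1,h\beta_1,0,\dots,0)$ and $B_H(U)=B^{SW}(h,hu_m,hv_m,h\alpha_1,h\beta_1,0,\dots,0)$, i.e. evaluated with $\alpha_i=\beta_i=0$ for $i\ge2$. *)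

theory Defs
  imports
    "HOL-Analysis.Analysis"
    "Jordan_Normal_Form.Matrix"
    "Jordan_Normal_Form.Gauss_Jordan_Elimination"
    "Jordan_Normal_Form.Determinant"
begin

unbundle no vec_syntax

text \<open>
  Vectors and matrices are those of Jordan_Normal_Form and are indexed from 0. A state
  \<open>U\<close> of the model with \<open>N\<close> moments has the entries \<open>U $ 0 = h\<close>, \<open>U $ 1 = h u\<^sub>m\<close>,
  \<open>U $ 2 = h v\<^sub>m\<close> and, for \<open>1 \<le> i \<le> N\<close>, \<open>U $ (2 i + 1) = h \<alpha>\<^sub>i\<close>, \<open>U $ (2 i + 2) = h \<beta>\<^sub>i\<close>.
\<close>

definition states :: "nat \<Rightarrow> real vec set" where
  "states N = {U \<in> carrier_vec (2 * N + 3). U $ 0 > 0}"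

definition ht :: "real vec \<Rightarrow> real" where "ht U = U $ 0"
definition um :: "real vec \<Rightarrow> real" where "um U = U $ 1 / ht U"
definition vm :: "real vec \<Rightarrow> real" where "vm U = U $ 2 / ht U"
definition \<alpha> :: "real vec \<Rightarrow> nat \<Rightarrow> real" where "\<alpha> U i = U $ (2 * i + 1) / ht U"
definition \<beta> :: "real vec \<Rightarrow> nat \<Rightarrow> real" where "\<beta> U i = U $ (2 * i + 2) / ht U"


section \<open>Rotations\<close>

definition rot2 :: "real \<Rightarrow> real mat" where
  "rot2 \<theta> = mat_of_rows_list 2 [[cos \<theta>, sin \<theta>], [- sin \<theta>, cos \<theta>]]"

definition rot :: "nat \<Rightarrow> real \<Rightarrow> real mat" where
  "rot N \<theta> = diag_block_mat (1\<^sub>m 1 # replicate (N + 1) (rot2 \<theta>))"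

text \<open>Only used for the rotation matrices, which are invertible, so \<^const>\<open>the\<close> is never applied
  to \<^const>\<open>None\<close> (lemmas \<open>minv_rot2\<close> and \<open>minv_rot\<close>).\<close>

definition minv :: "real mat \<Rightarrow> real mat" where
  "minv M = the (mat_inverse M)"

lemma minv_eqI:
  assumes A: "A \<in> carrier_mat n n" and B: "B \<in> carrier_mat n n" and AB: "A * B = 1\<^sub>m n"
  shows "minv A = B"
proof -
  have BA: "B * A = 1\<^sub>m n"
    using mat_mult_left_right_inverse[OF A B AB] .
  have "A \<in> Units (ring_mat TYPE(real) n ())"
    using A B AB BA by (auto simp: Units_def ring_mat_def)
  then obtain C where C: "mat_inverse A = Some C"
    using mat_inverse(1)[OF A, of "()"] by (cases "mat_inverse A") auto
  have C': "C * A = 1\<^sub>m n" "C \<in> carrier_mat n n"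
    using mat_inverse(2)[OF A C] by auto
  have "C = C * (A * B)" using AB C' by simp
  also have "\<dots> = (C * A) * B" using assoc_mult_mat[OF C'(2) A B] by simp
  also have "\<dots> = B" using B C' by simp
  finally show ?thesis using C by (simp add: minv_def)
qed

lemma rot2_carrier [simp]: "rot2 \<theta> \<in> carrier_mat 2 2"
  by (simp add: rot2_def mat_of_rows_list_def carrier_matI)

lemma rot2_mult: "rot2 \<theta> * rot2 (- \<theta>) = 1\<^sub>m 2"
proof -
  have 1: "{0..<2} = {0, 1 :: nat}" by auto
  have "cos \<theta> * cos \<theta> + sin \<theta> * sin \<theta> = 1"
    using sin_cos_squared_add3 by blast
  then show ?thesis
    by (intro eq_matI)
       (auto simp: rot2_def mat_of_rows_list_def scalar_prod_def 1 less_2_cases_iff add.commute)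
qed

lemma minv_rot2: "minv (rot2 \<theta>) = rot2 (- \<theta>)"
  by (rule minv_eqI[of _ 2]) (simp_all add: rot2_mult)

lemma diag_block_mat_replicate_carrier:
  assumes "A \<in> carrier_mat k k"
  shows "diag_block_mat (replicate m A) \<in> carrier_mat (m * k) (m * k)"
  using assms by (induction m) (auto simp: Let_def)

lemma diag_block_mat_replicate_mult:
  assumes A: "A \<in> carrier_mat k k" and B: "B \<in> carrier_mat k k" and AB: "A * B = 1\<^sub>m k"
  shows "diag_block_mat (replicate m A) * diag_block_mat (replicate m B) = 1\<^sub>m (m * k)"
proof (induction m)
  case (Suc m)
  let ?A = "diag_block_mat (replicate m A)" and ?B = "diag_block_mat (replicate m B)"
  have c: "?A \<in> carrier_mat (m * k) (m * k)" "?B \<in> carrier_mat (m * k) (m * k)"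
    using diag_block_mat_replicate_carrier A B by auto
  have "diag_block_mat (replicate (Suc m) A) * diag_block_mat (replicate (Suc m) B)
      = four_block_mat A (0\<^sub>m k (m * k)) (0\<^sub>m (m * k) k) ?A *
        four_block_mat B (0\<^sub>m k (m * k)) (0\<^sub>m (m * k) k) ?B"
    using A B c by (simp add: Let_def carrier_matD)
  also have "\<dots> = four_block_mat (1\<^sub>m k) (0\<^sub>m k (m * k)) (0\<^sub>m (m * k) k) (1\<^sub>m (m * k))"
    by (subst mult_four_block_mat[of _ k k _ "m * k" _ "m * k" _ _ k _ "m * k"])
       (use A B c AB Suc.IH in simp_all)
  finally show ?case by (simp add: four_block_one_mat)
qed auto

lemma rot_eq_four_block_mat:
  fixes N :: nat and \<theta> :: real
  defines "n \<equiv> (N + 1) * 2"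
  defines "D \<equiv> diag_block_mat (replicate (N + 1) (rot2 \<theta>))"
  shows "D \<in> carrier_mat n n"
    and "rot N \<theta> = four_block_mat (1\<^sub>m 1) (0\<^sub>m 1 n) (0\<^sub>m n 1) D"
proof -
  show D: "D \<in> carrier_mat n n"
    unfolding D_def n_def by (rule diag_block_mat_replicate_carrier) simp
  have "rot N \<theta> = four_block_mat (1\<^sub>m 1) (0\<^sub>m 1 (dim_col D)) (0\<^sub>m (dim_row D) 1) D"
    unfolding rot_def D_def diag_block_mat.simps(2) Let_def index_one_mat ..
  then show "rot N \<theta> = four_block_mat (1\<^sub>m 1) (0\<^sub>m 1 n) (0\<^sub>m n 1) D"
    by (simp only: carrier_matD[OF D])
qed

lemma rot_carrier: "rot N \<theta> \<in> carrier_mat (2 * N + 3) (2 * N + 3)"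
proof -
  have "rot N \<theta> \<in> carrier_mat (1 + (N + 1) * 2) (1 + (N + 1) * 2)"
    unfolding rot_eq_four_block_mat(2)
    by (rule four_block_carrier_mat[OF one_carrier_mat rot_eq_four_block_mat(1)])
  moreover have "1 + (N + 1) * 2 = 2 * N + 3" by simp
  ultimately show ?thesis by metis
qed

lemma minv_rot: "minv (rot N \<theta>) = rot N (- \<theta>)"
proof (rule minv_eqI[OF rot_carrier rot_carrier])
  define n where "n = (N + 1) * 2"
  define D where "D = (\<lambda>\<theta>. diag_block_mat (replicate (N + 1) (rot2 \<theta>)))"
  have c: "D \<theta> \<in> carrier_mat n n"
    and r: "rot N \<theta> = four_block_mat (1\<^sub>m 1) (0\<^sub>m 1 n) (0\<^sub>m n 1) (D \<theta>)" for \<theta>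
    unfolding D_def n_def by (rule rot_eq_four_block_mat)+
  have "D \<theta> * D (- \<theta>) = 1\<^sub>m n"
    unfolding D_def n_def by (rule diag_block_mat_replicate_mult) (simp_all add: rot2_mult)
  then have "rot N \<theta> * rot N (- \<theta>) = four_block_mat (1\<^sub>m 1) (0\<^sub>m 1 n) (0\<^sub>m n 1) (1\<^sub>m n)"
    unfolding r using c[of \<theta>] c[of "- \<theta>"]
    by (subst mult_four_block_mat[of _ 1 1 _ n _ n _ _ 1 _ n]) simp_all
  also have "\<dots> = 1\<^sub>m (1 + n)" by (rule four_block_one_mat)
  also have "1 + n = 2 * N + 3" by (simp add: n_def)
  finally show "rot N \<theta> * rot N (- \<theta>) = 1\<^sub>m (2 * N + 3)" .
qed


section \<open>Shifted Legendre polynomials\<close>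

text \<open>Rodrigues' formula \<open>\<phi>\<^sub>j(\<zeta>) = (1 / j!) (d/d\<zeta>)\<^sup>j (\<zeta> - \<zeta>\<^sup>2)\<^sup>j\<close>; the lemmas below establish
  the characterising properties (degree \<open>j\<close>, orthogonality on \<open>[0, 1]\<close>, \<open>\<phi>\<^sub>j(0) = 1\<close>).\<close>

definition \<phi> :: "nat \<Rightarrow> real poly" where
  "\<phi> j = Polynomial.smult (1 / fact j) ((pderiv ^^ j) ([:0, 1, -1:] ^ j))"

lemma degree_\<phi>: "Polynomial.degree (\<phi> j) = j"
  by (simp add: \<phi>_def degree_higher_pderiv degree_power_eq)

lemma poly_\<phi>_0: "poly (\<phi> j) 0 = 1"
proof -
  have "[:0, 1, -1:] = [:0, 1 :: real:] * [:1, -1:]"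
    by simp
  then have "[:0, 1, -1:] ^ j = (monom 1 j :: real poly) * [:1, -1:] ^ j"
    by (simp only: power_mult_distrib monom_altdef) simp
  then have "coeff ([:0, 1, -1:] ^ j) j = coeff ([:1, -1:] ^ j) (0 :: nat) * (1 :: real)"
    by (simp only: coeff_monom_mult) simp
  also have "\<dots> = 1" by (simp add: coeff_0_power)
  finally show ?thesis
    by (simp add: \<phi>_def poly_0_coeff_0 coeff_higher_pderiv flip: pochhammer_fact)
qed

lemma higher_pderiv_power_dvd: "m \<le> n \<Longrightarrow> q ^ (n - m) dvd (pderiv ^^ m) (q ^ n :: real poly)"
proof (induction m)
  case (Suc m)
  then obtain r where r: "(pderiv ^^ m) (q ^ n) = q ^ Suc (n - Suc m) * r"
    by (metis Suc_diff_Suc Suc_le_lessD dvd_def less_imp_le_nat)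
  have "(pderiv ^^ Suc m) (q ^ n) = pderiv (q ^ Suc (n - Suc m) * r)"
    by (simp add: r)
  also have "\<dots> = q ^ (n - Suc m) * (q * pderiv r
      + r * Polynomial.smult (of_nat (Suc (n - Suc m))) (pderiv q))"
    by (simp only: pderiv_mult pderiv_power_Suc) (simp add: algebra_simps)
  finally show ?case by (metis dvd_triv_left)
qed simp

lemma integral_pderiv_mult:
  fixes p q :: "real poly"
  assumes "poly p 0 = 0" "poly p 1 = 0"
  shows "integral {0..1} (\<lambda>x. poly (pderiv p) x * poly q x)
       = - integral {0..1} (\<lambda>x. poly p x * poly (pderiv q) x)"
proof -
  have "((\<lambda>x. poly (pderiv (p * q)) x) has_integral poly (p * q) 1 - poly (p * q) 0) {0..1}"
    by (rule fundamental_theorem_of_calculus)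
       (auto intro!: has_field_derivative_at_within poly_DERIV simp del: poly_mult
             simp: has_real_derivative_iff_has_vector_derivative[symmetric])
  then have "integral {0..1} (\<lambda>x. poly (pderiv p) x * poly q x + poly p x * poly (pderiv q) x) = 0"
    using assms by (simp add: integral_unique pderiv_mult algebra_simps)
  moreover have "(\<lambda>x. poly a x * poly b x) integrable_on {0..1}" for a b :: "real poly"
    by (intro integrable_continuous_real continuous_intros)
  ultimately show ?thesis by (simp add: Henstock_Kurzweil_Integration.integral_add)
qed

lemma integral_higher_pderiv_mult:
  fixes q :: "real poly"
  shows "m \<le> n \<Longrightarrow> integral {0..1} (\<lambda>x. poly ((pderiv ^^ m) ([:0, 1, -1:] ^ n)) x * poly q x)
     = (- 1) ^ m * integral {0..1} (\<lambda>x. poly ([:0, 1, -1:] ^ n) x * poly ((pderiv ^^ m) q) x)"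
proof (induction m arbitrary: q)
  case (Suc m)
  let ?p = "(pderiv ^^ m) ([:0, 1, -1:] ^ n) :: real poly"
  have "[:0, 1, -1:] dvd ([:0, 1, -1:] ^ (n - m) :: real poly)"
    using Suc.prems by (simp add: dvd_power)
  then have "[:0, 1, -1:] dvd ?p"
    using Suc.prems higher_pderiv_power_dvd[of m n "[:0, 1, -1:]"] by (meson Suc_leD dvd_trans)
  then obtain r where "?p = [:0, 1, -1:] * r"
    by (rule dvdE)
  then have "poly ?p 0 = 0" "poly ?p 1 = 0"
    by (simp_all only: poly_mult) simp_all
  then have "integral {0..1} (\<lambda>x. poly (pderiv ?p) x * poly q x)
      = - integral {0..1} (\<lambda>x. poly ?p x * poly (pderiv q) x)"
    by (rule integral_pderiv_mult)
  also have "\<dots> = - ((- 1) ^ m *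
      integral {0..1} (\<lambda>x. poly ([:0, 1, -1:] ^ n) x * poly ((pderiv ^^ m) (pderiv q)) x))"
    by (subst Suc.IH) (use Suc.prems in simp_all)
  finally have *: "integral {0..1} (\<lambda>x. poly (pderiv ?p) x * poly q x)
      = (- 1) ^ Suc m *
        integral {0..1} (\<lambda>x. poly ([:0, 1, -1:] ^ n) x * poly ((pderiv ^^ m) (pderiv q)) x)"
    by (simp only: power_Suc mult_minus1 mult_minus_left)
  have "pderiv ?p = (pderiv ^^ Suc m) ([:0, 1, -1:] ^ n)"
    by (simp only: funpow.simps o_apply)
  moreover have "(pderiv ^^ m) (pderiv q) = (pderiv ^^ Suc m) q"
    by (simp only: funpow_Suc_right o_apply)
  ultimately show ?case using * by (simp only:)
qed simp

lemma \<phi>_orthogonal_lower: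
  assumes "Polynomial.degree q < i"
  shows "integral {0..1} (\<lambda>x. poly (\<phi> i) x * poly q x) = 0"
proof -
  have "(pderiv ^^ i) q = 0"
  proof (rule poly_eqI)
    fix n show "coeff ((pderiv ^^ i) q) n = coeff 0 n"
      using assms by (simp add: coeff_higher_pderiv coeff_eq_0)
  qed
  then have "integral {0..1} (\<lambda>x. poly ((pderiv ^^ i) ([:0, 1, -1:] ^ i)) x * poly q x) = 0"
    by (subst integral_higher_pderiv_mult) simp_all
  then show ?thesis
    by (simp only: \<phi>_def poly_smult mult.assoc integral_mult_right mult_zero_right)
qed

lemma \<phi>_orthogonal: "i \<noteq> j \<Longrightarrow> integral {0..1} (\<lambda>x. poly (\<phi> i) x * poly (\<phi> j) x) = 0"
  using \<phi>_orthogonal_lower[of "\<phi> j" i] \<phi>_orthogonal_lower[of "\<phi> i" j]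
  by (cases i j rule: linorder_cases) (simp_all add: degree_\<phi> mult.commute)


section \<open>The hyperbolic shallow water moment equations\<close>

definition a :: "nat \<Rightarrow> nat \<Rightarrow> nat \<Rightarrow> real" where
  "a i j k = (2 * real i + 1) *
     integral {0..1} (\<lambda>\<zeta>. poly (\<phi> i) \<zeta> * poly (\<phi> j) \<zeta> * poly (\<phi> k) \<zeta>)"

definition b :: "nat \<Rightarrow> nat \<Rightarrow> nat \<Rightarrow> real" where
  "b i j k = (2 * real i + 1) *
     integral {0..1} (\<lambda>\<zeta>. poly (pderiv (\<phi> i)) \<zeta> * integral {0..\<zeta>} (poly (\<phi> j)) * poly (\<phi> k) \<zeta>)"

text \<open>In \<open>flux_F\<close> and \<open>flux_G\<close>, the rows \<open>r = 2 i + 1\<close> and \<open>r = 2 i + 2\<close> form the pair of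
  components belonging to the moment \<open>i = (r - 1) div 2\<close>.\<close>

definition flux_F :: "real \<Rightarrow> nat \<Rightarrow> real vec \<Rightarrow> real vec" where
  "flux_F g N U = Matrix.vec (2 * N + 3) (\<lambda>r.
     if r = 0 then ht U * um U
     else if r = 1 then
       ht U * ((um U)\<^sup>2 + (\<Sum>j=1..N. (\<alpha> U j)\<^sup>2 / (2 * real j + 1))) + 1 / 2 * g * (ht U)\<^sup>2
     else if r = 2 then
       ht U * (um U * vm U + (\<Sum>j=1..N. \<alpha> U j * \<beta> U j / (2 * real j + 1)))
     else let i = (r - 1) div 2 in
       if odd r then
         ht U * (2 * um U * \<alpha> U i + (\<Sum>j=1..N. \<Sum>k=1..N. a i j k * \<alpha> U j * \<alpha> U k))
       else
         ht U * (um U * \<beta> U i + vm U * \<alpha> U i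
                 + (\<Sum>j=1..N. \<Sum>k=1..N. a i j k * \<alpha> U j * \<beta> U k)))"

definition flux_G :: "real \<Rightarrow> nat \<Rightarrow> real vec \<Rightarrow> real vec" where
  "flux_G g N U = Matrix.vec (2 * N + 3) (\<lambda>r.
     if r = 0 then ht U * vm U
     else if r = 1 then
       ht U * (um U * vm U + (\<Sum>j=1..N. \<alpha> U j * \<beta> U j / (2 * real j + 1)))
     else if r = 2 then
       ht U * ((vm U)\<^sup>2 + (\<Sum>j=1..N. (\<beta> U j)\<^sup>2 / (2 * real j + 1))) + 1 / 2 * g * (ht U)\<^sup>2
     else let i = (r - 1) div 2 in
       if odd r then
         ht U * (um U * \<beta> U i + vm U * \<alpha> U i
                 + (\<Sum>j=1..N. \<Sum>k=1..N. a i j k * \<alpha> U j * \<beta> U k))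
       else
         ht U * (2 * vm U * \<beta> U i + (\<Sum>j=1..N. \<Sum>k=1..N. a i j k * \<beta> U j * \<beta> U k)))"

text \<open>Matrix of partial derivatives: entry \<open>(r, c)\<close> is \<open>\<partial>F\<^sub>r/\<partial>U\<^sub>c\<close> at \<open>U\<close>.\<close>

definition jac :: "(real vec \<Rightarrow> real vec) \<Rightarrow> real vec \<Rightarrow> real mat" where
  "jac F U = Matrix.mat (dim_vec (F U)) (dim_vec U)
     (\<lambda>(r, c). deriv (\<lambda>x. F (update_vec U c x) $ r) (U $ c))"

text \<open>The \<open>2n \<times> 2n\<close> matrix with the \<open>2 \<times> 2\<close> blocks \<open>M i j\<close>, \<open>1 \<le> i, j \<le> n\<close>.\<close>

definition block_mat :: "nat \<Rightarrow> (nat \<Rightarrow> nat \<Rightarrow> real mat) \<Rightarrow> real mat" where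
  "block_mat n M = Matrix.mat (2 * n) (2 * n)
     (\<lambda>(r, c). M (r div 2 + 1) (c div 2 + 1) $$ (r mod 2, c mod 2))"

text \<open>The same, bordered by \<open>m\<close> zero rows above and \<open>m\<close> zero columns on the left.\<close>

definition bordered :: "nat \<Rightarrow> nat \<Rightarrow> (nat \<Rightarrow> nat \<Rightarrow> real mat) \<Rightarrow> real mat" where
  "bordered m n M =
     four_block_mat (0\<^sub>m m m) (0\<^sub>m m (2 * n)) (0\<^sub>m (2 * n) m) (block_mat n M)"

definition P_block :: "nat \<Rightarrow> real vec \<Rightarrow> nat \<Rightarrow> nat \<Rightarrow> real mat" where
  "P_block N U i j = mat_of_rows_list 2
     [[- of_bool (i = j) * um U + (\<Sum>k=1..N. b i j k * \<alpha> U k), 0],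
      [- of_bool (i = j) * vm U + (\<Sum>k=1..N. b i j k * \<beta> U k), 0]]"

definition Q_block :: "nat \<Rightarrow> real vec \<Rightarrow> nat \<Rightarrow> nat \<Rightarrow> real mat" where
  "Q_block N U i j = mat_of_rows_list 2
     [[0, - of_bool (i = j) * um U + (\<Sum>k=1..N. b i j k * \<alpha> U k)],
      [0, - of_bool (i = j) * vm U + (\<Sum>k=1..N. b i j k * \<beta> U k)]]"

definition A_SW :: "real \<Rightarrow> nat \<Rightarrow> real vec \<Rightarrow> real mat" where
  "A_SW g N U = jac (flux_F g N) U + bordered 3 N (P_block N U)"

definition B_SW :: "real \<Rightarrow> nat \<Rightarrow> real vec \<Rightarrow> real mat" where
  "B_SW g N U = jac (flux_G g N) U + bordered 3 N (Q_block N U)"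

text \<open>\<open>truncate_state\<close> keeps the entries \<open>h, h u\<^sub>m, h v\<^sub>m, h \<alpha>\<^sub>1, h \<beta>\<^sub>1\<close>. In \<open>A_H\<close> and \<open>B_H\<close> the
  Jacobian is taken first, with respect to all variables, and evaluated there afterwards.\<close>

definition truncate_state :: "nat \<Rightarrow> real vec \<Rightarrow> real vec" where
  "truncate_state N U = Matrix.vec (2 * N + 3) (\<lambda>r. if r < 5 then U $ r else 0)"

definition A_H :: "real \<Rightarrow> nat \<Rightarrow> real vec \<Rightarrow> real mat" where
  "A_H g N U = A_SW g N (truncate_state N U)"

definition B_H :: "real \<Rightarrow> nat \<Rightarrow> real vec \<Rightarrow> real mat" where
  "B_H g N U = B_SW g N (truncate_state N U)"

end

theory Submission
  imports Defs
begin

text \<open>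
  The HSWME part splits into a Jacobian and a nonconservative part. The fluxes satisfy
  \<open>F(T U) = T (cos \<theta> F(U) + sin \<theta> G(U))\<close>, using that \<open>a\<^sub>i\<^sub>j\<^sub>k\<close> is symmetric in \<open>j, k\<close>; as
  \<open>T\<close> is linear, the chain rule turns this into the invariance of the Jacobians. Each block
  of \<open>P\<close> and \<open>Q\<close> is a column that rotates like a velocity times the row \<open>(1, 0)\<close> or \<open>(0, 1)\<close>,
  and \<open>(1, 0) T\<^sub>2 = (cos \<theta>, sin \<theta>)\<close>. Finally \<open>T\<close> is block diagonal and commutes with the
  truncation to the first moment, so invariance of the full matrices can be checked blockwise.
\<close>

section \<open>Rotations\<close>

lemma rot2_index [simp]:
  "rot2 \<theta> $$ (0, 0) = cos \<theta>" "rot2 \<theta> $$ (0, Suc 0) = sin \<theta>"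
  "rot2 \<theta> $$ (Suc 0, 0) = - sin \<theta>" "rot2 \<theta> $$ (Suc 0, Suc 0) = cos \<theta>"
  "dim_row (rot2 \<theta>) = 2" "dim_col (rot2 \<theta>) = 2"
  by (simp_all add: rot2_def mat_of_rows_list_def)

text \<open>Induction on \<open>m\<close>, splitting off the first block. It occupies the indices
  below \<open>k\<close>; for the remaining blocks both indices are shifted by \<open>k\<close>,
  which lowers the quotients by one and keeps the remainders.\<close>

lemma diag_block_mat_replicate_index:
  assumes A: "M \<in> carrier_mat k k" and "r < m * k" "c < m * k"
  shows "diag_block_mat (replicate m M) $$ (r, c)
       = (if r div k = c div k then M $$ (r mod k, c mod k) else 0)"
  using assms(2,3)
proof (induction m arbitrary: r c)
  case (Suc m)
  let ?D = "diag_block_mat (replicate m M)"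
  have D: "?D \<in> carrier_mat (m * k) (m * k)"
    by (rule diag_block_mat_replicate_carrier[OF A])
  have k: "k > 0" using Suc.prems by (cases k) auto
  have "diag_block_mat (replicate (Suc m) M) $$ (r, c)
      = four_block_mat M (0\<^sub>m k (m * k)) (0\<^sub>m (m * k) k) ?D $$ (r, c)"
    using A D by (simp add: Let_def carrier_matD)
  also have "\<dots> = (if r < k then if c < k then M $$ (r, c) else 0
      else if c < k then 0 else ?D $$ (r - k, c - k))"
    using Suc.prems A D by (subst index_mat_four_block) auto
  also have "\<dots> = (if r div k = c div k then M $$ (r mod k, c mod k) else 0)"
  proof (cases "r < k \<or> c < k")
    case True
    then show ?thesis using k by (auto simp: div_eq_0_iff)
  next
    case False
    then have "r - k < m * k" "c - k < m * k" using Suc.prems by auto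
    then show ?thesis
      using Suc.IH[of "r - k" "c - k"] False k by (auto simp: le_div_geq le_mod_geq)
  qed
  finally show ?case .
qed simp

text \<open>The leading \<open>1\<close> of \<open>rot\<close> moves the \<open>2 x 2\<close> blocks
  by one place, hence the offsets \<open>r - 1\<close> and \<open>c - 1\<close>.\<close>

lemma rot_index:
  assumes "r < 2 * N + 3" "c < 2 * N + 3"
  shows "rot N \<theta> $$ (r, c) =
    (if r = 0 \<or> c = 0 then of_bool (r = c)
     else if (r - 1) div 2 = (c - 1) div 2 then rot2 \<theta> $$ ((r - 1) mod 2, (c - 1) mod 2) else 0)"
proof -
  define D where "D = diag_block_mat (replicate (N + 1) (rot2 \<theta>))"
  have D: "D \<in> carrier_mat ((N + 1) * 2) ((N + 1) * 2)"
    unfolding D_def by (rule rot_eq_four_block_mat(1))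
  have "D $$ (r', c') = (if r' div 2 = c' div 2 then rot2 \<theta> $$ (r' mod 2, c' mod 2) else 0)"
    if "r' < (N + 1) * 2" "c' < (N + 1) * 2" for r' c'
    unfolding D_def using that by (rule diag_block_mat_replicate_index[OF rot2_carrier])
  then show ?thesis
    unfolding rot_eq_four_block_mat(2) D_def[symmetric]
    using assms by (subst index_mat_four_block) (auto simp: carrier_matD[OF D])
qed

text \<open>This matches the layout of a state: entry 0 is the height, pair \<open>i = 0\<close> is
  the mean momentum, and the pairs with \<open>i \<ge> 1\<close> are the moments. All pairs rotate
  in the same way, so the mean velocity is treated as pair 0 from here on.\<close>

lemma sum_odd_even_pairs:
  fixes f :: "nat \<Rightarrow> real"
  shows "(\<Sum>k = 0..<2 * N + 3. f k) = f 0 + (\<Sum>i\<le>N. f (2 * i + 1) + f (2 * i + 2))"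
  by (induction N) (simp_all add: numeral_eq_Suc)

text \<open>Each row of \<open>rot\<close> is supported either on entry 0 or on a single pair, so
  the sum over all columns collapses to at most two terms.\<close>

lemma rot_mult_vec_index:
  assumes v: "v \<in> carrier_vec (2 * N + 3)"
  shows "(rot N \<theta> *\<^sub>v v) $ 0 = v $ 0"
    and "i \<le> N \<Longrightarrow>
      (rot N \<theta> *\<^sub>v v) $ (2 * i + 1) = cos \<theta> * v $ (2 * i + 1) + sin \<theta> * v $ (2 * i + 2)"
    and "i \<le> N \<Longrightarrow>
      (rot N \<theta> *\<^sub>v v) $ (2 * i + 2) = - sin \<theta> * v $ (2 * i + 1) + cos \<theta> * v $ (2 * i + 2)"
proof -
  have *: "(rot N \<theta> *\<^sub>v v) $ r = rot N \<theta> $$ (r, 0) * v $ 0 +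
      (\<Sum>i\<le>N. rot N \<theta> $$ (r, 2 * i + 1) * v $ (2 * i + 1)
            + rot N \<theta> $$ (r, 2 * i + 2) * v $ (2 * i + 2))"
    if r: "r < 2 * N + 3" for r
  proof -
    have "(rot N \<theta> *\<^sub>v v) $ r = (\<Sum>k = 0..<2 * N + 3. rot N \<theta> $$ (r, k) * v $ k)"
      using r v rot_carrier[of N \<theta>] by (auto simp: scalar_prod_def)
    then show ?thesis by (simp only: sum_odd_even_pairs)
  qed
  show "(rot N \<theta> *\<^sub>v v) $ 0 = v $ 0"
    by (subst *) (auto simp: rot_index intro!: sum.neutral)
  \<comment> \<open>Only the pair \<open>k = i\<close> survives; \<open>x\<close> and
    \<open>y\<close> will be the two entries of a row of \<open>rot2 \<theta>\<close>.\<close>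
  have delta: "(\<Sum>k\<le>N. (if i = k then x else 0) * v $ (2 * k + 1)
        + (if i = k then y else 0) * v $ (2 * k + 2))
      = x * v $ (2 * i + 1) + y * v $ (2 * i + 2)" if "i \<le> N" for i x y
  proof -
    have "(\<Sum>k\<le>N. (if i = k then x else 0) * v $ (2 * k + 1)
        + (if i = k then y else 0) * v $ (2 * k + 2))
      = (\<Sum>k\<le>N. if i = k then x * v $ (2 * k + 1) + y * v $ (2 * k + 2) else 0)"
      by (intro sum.cong) auto
    then show ?thesis using that by simp
  qed
  show "(rot N \<theta> *\<^sub>v v) $ (2 * i + 1) = cos \<theta> * v $ (2 * i + 1) + sin \<theta> * v $ (2 * i + 2)"
    if i: "i \<le> N"
  proof -
    have "(\<Sum>k\<le>N. rot N \<theta> $$ (2 * i + 1, 2 * k + 1) * v $ (2 * k + 1)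
            + rot N \<theta> $$ (2 * i + 1, 2 * k + 2) * v $ (2 * k + 2)) =
       (\<Sum>k\<le>N. (if i = k then cos \<theta> else 0) * v $ (2 * k + 1)
        + (if i = k then sin \<theta> else 0) * v $ (2 * k + 2))"
      using i by (intro sum.cong refl) (auto simp: rot_index)
    moreover have "rot N \<theta> $$ (2 * i + 1, 0) = 0" "2 * i + 1 < 2 * N + 3"
      using i by (simp_all add: rot_index)
    ultimately show ?thesis by (simp only: * delta[OF i] mult_zero_left add_0_left)
  qed
  show "(rot N \<theta> *\<^sub>v v) $ (2 * i + 2) = - sin \<theta> * v $ (2 * i + 1) + cos \<theta> * v $ (2 * i + 2)"
    if i: "i \<le> N"
  proof -
    have "(\<Sum>k\<le>N. rot N \<theta> $$ (2 * i + 2, 2 * k + 1) * v $ (2 * k + 1)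
            + rot N \<theta> $$ (2 * i + 2, 2 * k + 2) * v $ (2 * k + 2)) =
       (\<Sum>k\<le>N. (if i = k then - sin \<theta> else 0) * v $ (2 * k + 1)
        + (if i = k then cos \<theta> else 0) * v $ (2 * k + 2))"
      using i by (intro sum.cong refl) (auto simp: rot_index)
    moreover have "rot N \<theta> $$ (2 * i + 2, 0) = 0" "2 * i + 2 < 2 * N + 3"
      using i by (simp_all add: rot_index)
    ultimately show ?thesis by (simp only: * delta[OF i] mult_zero_left add_0_left)
  qed
qed

lemma rot_mult_vec_carrier: "v \<in> carrier_vec (2 * N + 3) \<Longrightarrow> rot N \<theta> *\<^sub>v v \<in> carrier_vec (2 * N + 3)"
  using rot_carrier by (rule mult_mat_vec_carrier)

text \<open>Transposing \<open>rot2 \<theta>\<close> flips the sign of the sine, that is, of the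
  angle. This is what turns multiplication from the right into an action on rows.\<close>

lemma transpose_rot: "transpose_mat (rot N \<theta>) = rot N (- \<theta>)"
proof (rule eq_matI)
  fix r c assume "r < dim_row (rot N (- \<theta>))" "c < dim_col (rot N (- \<theta>))"
  then have rc: "r < 2 * N + 3" "c < 2 * N + 3"
    using rot_carrier[of N "- \<theta>"] by auto
  have *: "rot2 \<theta> $$ (q, p) = rot2 (- \<theta>) $$ (p, q)" if "p < 2" "q < 2" for p q
    using that by (auto simp: less_2_cases_iff)
  have "transpose_mat (rot N \<theta>) $$ (r, c) = rot N \<theta> $$ (c, r)"
    using rc rot_carrier[of N \<theta>] by simp
  also have "\<dots> = rot N (- \<theta>) $$ (r, c)"
    using rc by (cases "r = 0 \<or> c = 0"; cases "(r - 1) div 2 = (c - 1) div 2")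
      (auto simp: rot_index *)
  finally show "transpose_mat (rot N \<theta>) $$ (r, c) = rot N (- \<theta>) $$ (r, c)" .
qed (use rot_carrier[of N \<theta>] rot_carrier[of N "- \<theta>"] in auto)

lemma rot_inverse: "rot N (- \<theta>) * rot N \<theta> = 1\<^sub>m (2 * N + 3)"
proof -
  define n where "n = (N + 1) * 2"
  define D where "D = (\<lambda>\<theta>. diag_block_mat (replicate (N + 1) (rot2 \<theta>)))"
  have c: "D \<theta> \<in> carrier_mat n n"
    and r: "rot N \<theta> = four_block_mat (1\<^sub>m 1) (0\<^sub>m 1 n) (0\<^sub>m n 1) (D \<theta>)" for \<theta>
    unfolding D_def n_def by (rule rot_eq_four_block_mat)+
  have "D (- \<theta>) * D \<theta> = 1\<^sub>m n"
    unfolding D_def n_def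
    by (rule diag_block_mat_replicate_mult) (use rot2_mult[of "- \<theta>"] in simp_all)
  then have "rot N (- \<theta>) * rot N \<theta> = four_block_mat (1\<^sub>m 1) (0\<^sub>m 1 n) (0\<^sub>m n 1) (1\<^sub>m n)"
    unfolding r using c[of \<theta>] c[of "- \<theta>"]
    by (subst mult_four_block_mat[of _ 1 1 _ n _ n _ _ 1 _ n]) simp_all
  also have "\<dots> = 1\<^sub>m (1 + n)" by (rule four_block_one_mat)
  finally show ?thesis by (simp add: n_def numeral_eq_Suc)
qed

text \<open>Right multiplication by \<open>rot N \<theta>\<close> acts on each row by the transpose
  \<open>rot N (- \<theta>)\<close>. The formulas of \<open>rot_mult_vec_index\<close> thus serve
  for both factors of a conjugation.\<close>

lemma mult_rot_index:
  assumes X: "X \<in> carrier_mat (2 * N + 3) (2 * N + 3)" and "r < 2 * N + 3" "c < 2 * N + 3"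
  shows "(X * rot N \<theta>) $$ (r, c) = (rot N (- \<theta>) *\<^sub>v row X r) $ c"
proof -
  have "(X * rot N \<theta>) $$ (r, c) = row X r \<bullet> col (rot N \<theta>) c"
    using assms rot_carrier[of N \<theta>] by simp
  also have "\<dots> = col (rot N \<theta>) c \<bullet> row X r"
    using assms rot_carrier[of N \<theta>] by (intro comm_scalar_prod[of _ "2 * N + 3"]) auto
  also have "col (rot N \<theta>) c = row (rot N (- \<theta>)) c"
    using assms rot_carrier[of N \<theta>] by (simp flip: transpose_rot)
  finally show ?thesis
    using assms rot_carrier[of N "- \<theta>"] by simp
qed

lemma rot_mult_index:
  assumes X: "X \<in> carrier_mat (2 * N + 3) (2 * N + 3)" and "r < 2 * N + 3" "c < 2 * N + 3"
  shows "(rot N \<theta> * X) $$ (r, c) = (rot N \<theta> *\<^sub>v col X c) $ r"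
  using assms rot_carrier[of N \<theta>] by simp

section \<open>Block matrices\<close>

lemma bordered_carrier: "bordered m n M \<in> carrier_mat (m + 2 * n) (m + 2 * n)"
  by (simp add: bordered_def block_mat_def four_block_carrier_mat)

lemma bordered_dim:
  "dim_row (bordered m n M) = m + 2 * n" "dim_col (bordered m n M) = m + 2 * n"
  using bordered_carrier[of m n M] by auto

lemma bordered_index:
  assumes "r < m + 2 * n" "c < m + 2 * n"
  shows "bordered m n M $$ (r, c) = (if r < m \<or> c < m then 0
     else M ((r - m) div 2 + 1) ((c - m) div 2 + 1) $$ ((r - m) mod 2, (c - m) mod 2))"
  using assms by (auto simp: bordered_def block_mat_def)

lemma index_cases:
  fixes r :: nat
  assumes "r < 2 * N + 3"
  obtains "r = 0" | i where "i \<le> N" "r = 2 * i + 1" | i where "i \<le> N" "r = 2 * i + 2"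
proof (cases r)
  case (Suc k)
  show ?thesis
  proof (cases "even k")
    case True
    then obtain i where "k = 2 * i" by (rule evenE)
    then show ?thesis using Suc assms by (intro that(2)[of i]) auto
  next
    case False
    then obtain i where "k = 2 * i + 1" by (rule oddE)
    then show ?thesis using Suc assms by (intro that(3)[of i]) auto
  qed
qed (use that in auto)

section \<open>Conjugation by rotations, entry by entry\<close>

lemma rot2_conj_index:
  assumes M: "M \<in> carrier_mat 2 2"
  shows "(rot2 (- \<theta>) * M * rot2 \<theta>) $$ (0, 0) =
      cos \<theta> * (cos \<theta> * M $$ (0, 0) - sin \<theta> * M $$ (1, 0))
      - sin \<theta> * (cos \<theta> * M $$ (0, 1) - sin \<theta> * M $$ (1, 1))"
    "(rot2 (- \<theta>) * M * rot2 \<theta>) $$ (0, 1) =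
      sin \<theta> * (cos \<theta> * M $$ (0, 0) - sin \<theta> * M $$ (1, 0))
      + cos \<theta> * (cos \<theta> * M $$ (0, 1) - sin \<theta> * M $$ (1, 1))"
    "(rot2 (- \<theta>) * M * rot2 \<theta>) $$ (1, 0) =
      cos \<theta> * (sin \<theta> * M $$ (0, 0) + cos \<theta> * M $$ (1, 0))
      - sin \<theta> * (sin \<theta> * M $$ (0, 1) + cos \<theta> * M $$ (1, 1))"
    "(rot2 (- \<theta>) * M * rot2 \<theta>) $$ (1, 1) =
      sin \<theta> * (sin \<theta> * M $$ (0, 0) + cos \<theta> * M $$ (1, 0))
      + cos \<theta> * (sin \<theta> * M $$ (0, 1) + cos \<theta> * M $$ (1, 1))"
proof -
  have "{0..<2} = {0, 1 :: nat}" by auto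
  then show "(rot2 (- \<theta>) * M * rot2 \<theta>) $$ (0, 0) =
      cos \<theta> * (cos \<theta> * M $$ (0, 0) - sin \<theta> * M $$ (1, 0))
      - sin \<theta> * (cos \<theta> * M $$ (0, 1) - sin \<theta> * M $$ (1, 1))"
    "(rot2 (- \<theta>) * M * rot2 \<theta>) $$ (0, 1) =
      sin \<theta> * (cos \<theta> * M $$ (0, 0) - sin \<theta> * M $$ (1, 0))
      + cos \<theta> * (cos \<theta> * M $$ (0, 1) - sin \<theta> * M $$ (1, 1))"
    "(rot2 (- \<theta>) * M * rot2 \<theta>) $$ (1, 0) =
      cos \<theta> * (sin \<theta> * M $$ (0, 0) + cos \<theta> * M $$ (1, 0))
      - sin \<theta> * (sin \<theta> * M $$ (0, 1) + cos \<theta> * M $$ (1, 1))"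
    "(rot2 (- \<theta>) * M * rot2 \<theta>) $$ (1, 1) =
      sin \<theta> * (sin \<theta> * M $$ (0, 0) + cos \<theta> * M $$ (1, 0))
      + cos \<theta> * (sin \<theta> * M $$ (0, 1) + cos \<theta> * M $$ (1, 1))"
    using M by (simp_all add: scalar_prod_def algebra_simps)
qed

text \<open>With respect to the partition into entry 0 and the pairs, conjugation mixes rows only
  within a pair of rows and columns only within a pair of columns. The formulas for two pairs are
  bracketed exactly as in \<open>rot2_conj_index\<close>, so that blocks can be compared by
  rewriting alone.\<close>

lemma rot_conj_index:
  fixes \<theta> :: real and i j :: nat
  assumes X: "X \<in> carrier_mat (2 * N + 3) (2 * N + 3)"
  defines "Y \<equiv> rot N (- \<theta>) * X * rot N \<theta>"
  shows "Y $$ (0, 0) = X $$ (0, 0)"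
    "j \<le> N \<Longrightarrow> Y $$ (0, 2 * j + 1) = cos \<theta> * X $$ (0, 2 * j + 1) - sin \<theta> * X $$ (0, 2 * j + 2)"
    "j \<le> N \<Longrightarrow> Y $$ (0, 2 * j + 2) = sin \<theta> * X $$ (0, 2 * j + 1) + cos \<theta> * X $$ (0, 2 * j + 2)"
    "i \<le> N \<Longrightarrow> Y $$ (2 * i + 1, 0) = cos \<theta> * X $$ (2 * i + 1, 0) - sin \<theta> * X $$ (2 * i + 2, 0)"
    "i \<le> N \<Longrightarrow> Y $$ (2 * i + 2, 0) = sin \<theta> * X $$ (2 * i + 1, 0) + cos \<theta> * X $$ (2 * i + 2, 0)"
    "\<lbrakk>i \<le> N; j \<le> N\<rbrakk> \<Longrightarrow> Y $$ (2 * i + 1, 2 * j + 1) =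
      cos \<theta> * (cos \<theta> * X $$ (2 * i + 1, 2 * j + 1) - sin \<theta> * X $$ (2 * i + 2, 2 * j + 1))
      - sin \<theta> * (cos \<theta> * X $$ (2 * i + 1, 2 * j + 2) - sin \<theta> * X $$ (2 * i + 2, 2 * j + 2))"
    "\<lbrakk>i \<le> N; j \<le> N\<rbrakk> \<Longrightarrow> Y $$ (2 * i + 1, 2 * j + 2) =
      sin \<theta> * (cos \<theta> * X $$ (2 * i + 1, 2 * j + 1) - sin \<theta> * X $$ (2 * i + 2, 2 * j + 1))
      + cos \<theta> * (cos \<theta> * X $$ (2 * i + 1, 2 * j + 2) - sin \<theta> * X $$ (2 * i + 2, 2 * j + 2))"
    "\<lbrakk>i \<le> N; j \<le> N\<rbrakk> \<Longrightarrow> Y $$ (2 * i + 2, 2 * j + 1) =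
      cos \<theta> * (sin \<theta> * X $$ (2 * i + 1, 2 * j + 1) + cos \<theta> * X $$ (2 * i + 2, 2 * j + 1))
      - sin \<theta> * (sin \<theta> * X $$ (2 * i + 1, 2 * j + 2) + cos \<theta> * X $$ (2 * i + 2, 2 * j + 2))"
    "\<lbrakk>i \<le> N; j \<le> N\<rbrakk> \<Longrightarrow> Y $$ (2 * i + 2, 2 * j + 2) =
      sin \<theta> * (sin \<theta> * X $$ (2 * i + 1, 2 * j + 1) + cos \<theta> * X $$ (2 * i + 2, 2 * j + 1))
      + cos \<theta> * (sin \<theta> * X $$ (2 * i + 1, 2 * j + 2) + cos \<theta> * X $$ (2 * i + 2, 2 * j + 2))"
proof -
  let ?n = "2 * N + 3" and ?Z = "rot N (- \<theta>) * X"
  have Z: "?Z \<in> carrier_mat ?n ?n" using rot_carrier X by (rule mult_carrier_mat)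
  have row: "row ?Z r \<in> carrier_vec ?n" for r by (rule carrier_vecI) (simp add: carrier_matD[OF Z] del: index_mult_mat)
  have col: "col X c \<in> carrier_vec ?n" for c by (rule carrier_vecI) (simp add: carrier_matD[OF X])
  have lt: "0 < ?n" "k \<le> N \<Longrightarrow> 2 * k + 1 < ?n" "k \<le> N \<Longrightarrow> 2 * k + 2 < ?n" for k
    by auto
  have Zrow: "row ?Z r $ c = ?Z $$ (r, c)" if "r < ?n" "c < ?n" for r c
    by (rule index_row(1)) (simp_all only: carrier_matD[OF Z] that)
  have Xcol: "col X c $ r = X $$ (r, c)" if "r < ?n" "c < ?n" for r c
    by (rule index_col) (simp_all only: carrier_matD[OF X] that)
  \<comment> \<open>The rules first resolve the right factor as a rotation of the rows of
    \<open>?Z\<close>, then the left factor as a rotation of the columns of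
    \<open>X\<close>.\<close>
  note Y = mult_rot_index[OF Z] rot_mult_vec_index(1)[OF row] rot_mult_vec_index(2,3)[OF row]
    Zrow rot_mult_index[OF X] rot_mult_vec_index(1)[OF col] rot_mult_vec_index(2,3)[OF col] Xcol
    lt cos_minus sin_minus minus_minus mult_minus_left add_uminus_conv_diff
  show "Y $$ (0, 0) = X $$ (0, 0)"
    "j \<le> N \<Longrightarrow> Y $$ (0, 2 * j + 1) = cos \<theta> * X $$ (0, 2 * j + 1) - sin \<theta> * X $$ (0, 2 * j + 2)"
    "j \<le> N \<Longrightarrow> Y $$ (0, 2 * j + 2) = sin \<theta> * X $$ (0, 2 * j + 1) + cos \<theta> * X $$ (0, 2 * j + 2)"
    "i \<le> N \<Longrightarrow> Y $$ (2 * i + 1, 0) = cos \<theta> * X $$ (2 * i + 1, 0) - sin \<theta> * X $$ (2 * i + 2, 0)"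
    "i \<le> N \<Longrightarrow> Y $$ (2 * i + 2, 0) = sin \<theta> * X $$ (2 * i + 1, 0) + cos \<theta> * X $$ (2 * i + 2, 0)"
    "\<lbrakk>i \<le> N; j \<le> N\<rbrakk> \<Longrightarrow> Y $$ (2 * i + 1, 2 * j + 1) =
      cos \<theta> * (cos \<theta> * X $$ (2 * i + 1, 2 * j + 1) - sin \<theta> * X $$ (2 * i + 2, 2 * j + 1))
      - sin \<theta> * (cos \<theta> * X $$ (2 * i + 1, 2 * j + 2) - sin \<theta> * X $$ (2 * i + 2, 2 * j + 2))"
    "\<lbrakk>i \<le> N; j \<le> N\<rbrakk> \<Longrightarrow> Y $$ (2 * i + 1, 2 * j + 2) =
      sin \<theta> * (cos \<theta> * X $$ (2 * i + 1, 2 * j + 1) - sin \<theta> * X $$ (2 * i + 2, 2 * j + 1))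
      + cos \<theta> * (cos \<theta> * X $$ (2 * i + 1, 2 * j + 2) - sin \<theta> * X $$ (2 * i + 2, 2 * j + 2))"
    "\<lbrakk>i \<le> N; j \<le> N\<rbrakk> \<Longrightarrow> Y $$ (2 * i + 2, 2 * j + 1) =
      cos \<theta> * (sin \<theta> * X $$ (2 * i + 1, 2 * j + 1) + cos \<theta> * X $$ (2 * i + 2, 2 * j + 1))
      - sin \<theta> * (sin \<theta> * X $$ (2 * i + 1, 2 * j + 2) + cos \<theta> * X $$ (2 * i + 2, 2 * j + 2))"
    "\<lbrakk>i \<le> N; j \<le> N\<rbrakk> \<Longrightarrow> Y $$ (2 * i + 2, 2 * j + 2) =
      sin \<theta> * (sin \<theta> * X $$ (2 * i + 1, 2 * j + 1) + cos \<theta> * X $$ (2 * i + 2, 2 * j + 1))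
      + cos \<theta> * (sin \<theta> * X $$ (2 * i + 1, 2 * j + 2) + cos \<theta> * X $$ (2 * i + 2, 2 * j + 2))"
    unfolding Y_def by (simp_all only: Y)
qed

text \<open>A zero border of width one stays zero, and since \<open>rot\<close> is block diagonal
  with equal blocks, every block of \<open>M\<close> is conjugated on its own.\<close>

lemma bordered_rot_conj:
  assumes M: "\<And>i j. i \<in> {1..N+1} \<Longrightarrow> j \<in> {1..N+1} \<Longrightarrow> M i j \<in> carrier_mat 2 2"
  shows "rot N (- \<theta>) * bordered 1 (N + 1) M * rot N \<theta>
       = bordered 1 (N + 1) (\<lambda>i j. rot2 (- \<theta>) * M i j * rot2 \<theta>)" (is "?L = ?R")
proof (rule eq_matI)
  let ?X = "bordered 1 (N + 1) M" and ?n = "2 * N + 3"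
  have X: "?X \<in> carrier_mat ?n ?n"
    using bordered_carrier[of 1 "N + 1" M] by (simp add: numeral_eq_Suc)
  have R: "?R \<in> carrier_mat ?n ?n"
    using bordered_carrier[of 1 "N + 1"] by (simp add: numeral_eq_Suc)
  fix r c assume "r < dim_row ?R" "c < dim_col ?R"
  then have r: "r < ?n" and c: "c < ?n" using R by auto
  have idx0: "bordered 1 (N + 1) M' $$ (0, k) = 0" "bordered 1 (N + 1) M' $$ (k, 0) = 0"
    if "k < ?n" for M' k
    using that by (simp_all add: bordered_index)
  have idx: "bordered 1 (N + 1) M' $$ (2 * i + 1, 2 * j + 1) = M' (i + 1) (j + 1) $$ (0, 0)"
    "bordered 1 (N + 1) M' $$ (2 * i + 1, 2 * j + 2) = M' (i + 1) (j + 1) $$ (0, 1)"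
    "bordered 1 (N + 1) M' $$ (2 * i + 2, 2 * j + 1) = M' (i + 1) (j + 1) $$ (1, 0)"
    "bordered 1 (N + 1) M' $$ (2 * i + 2, 2 * j + 2) = M' (i + 1) (j + 1) $$ (1, 1)"
    if "i \<le> N" "j \<le> N" for M' i j
    using that by (simp_all add: bordered_index)
  have lt: "0 < ?n" "k \<le> N \<Longrightarrow> 2 * k + 1 < ?n" "k \<le> N \<Longrightarrow> 2 * k + 2 < ?n" for k
    by auto
  have M': "M (i + 1) (j + 1) \<in> carrier_mat 2 2" if "i \<le> N" "j \<le> N" for i j
    using that by (intro M) auto
  note eqs = rot_conj_index[OF X] rot2_conj_index[OF M'] idx0 idx lt
    mult_zero_right diff_zero add_0_left
  show "?L $$ (r, c) = ?R $$ (r, c)"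
    by (cases rule: index_cases[OF r]; cases rule: index_cases[OF c]; simp only: eqs)
qed (simp_all add: bordered_dim carrier_matD[OF rot_carrier])

section \<open>The chain rule for Jacobians\<close>

text \<open>The vectors of Jordan_Normal_Form carry no topology. Differentiability at a point is
  therefore expressed by the chain rule along curves, which is stable under composition with
  linear maps.\<close>

definition has_gradient :: "nat \<Rightarrow> (real vec \<Rightarrow> real) \<Rightarrow> (nat \<Rightarrow> real) \<Rightarrow> real vec \<Rightarrow> bool" where
  "has_gradient n f D U \<longleftrightarrow> (\<forall>\<gamma> V t. \<gamma> t = U \<longrightarrow>
     (\<forall>i<n. ((\<lambda>s. \<gamma> s $ i) has_real_derivative V i) (at t)) \<longrightarrow>
     ((\<lambda>s. f (\<gamma> s)) has_real_derivative (\<Sum>i<n. D i * V i)) (at t))"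

definition vec_differentiable :: "nat \<Rightarrow> (real vec \<Rightarrow> real) \<Rightarrow> real vec \<Rightarrow> bool" where
  "vec_differentiable n f U \<longleftrightarrow> (\<exists>D. has_gradient n f D U)"

lemma vec_differentiableI:
  assumes "\<And>\<gamma> V t. \<gamma> t = U \<Longrightarrow> (\<And>i. i < n \<Longrightarrow> ((\<lambda>s. \<gamma> s $ i) has_real_derivative V i) (at t)) \<Longrightarrow>
     ((\<lambda>s. f (\<gamma> s)) has_real_derivative (\<Sum>i<n. D i * V i)) (at t)"
  shows "vec_differentiable n f U"
  unfolding vec_differentiable_def has_gradient_def by (intro exI[of _ D] allI impI assms) auto

lemma has_gradientD:
  assumes "has_gradient n f D U" "\<gamma> t = U"
    "\<And>i. i < n \<Longrightarrow> ((\<lambda>s. \<gamma> s $ i) has_real_derivative V i) (at t)"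
  shows "((\<lambda>s. f (\<gamma> s)) has_real_derivative (\<Sum>i<n. D i * V i)) (at t)"
  using assms unfolding has_gradient_def by blast

section \<open>Closure rules for differentiability\<close>

lemma vec_differentiable_const: "vec_differentiable n (\<lambda>_. k) U"
  by (rule vec_differentiableI[where D = "\<lambda>_. 0"]) simp

lemma vec_differentiable_index:
  assumes "i < n" shows "vec_differentiable n (\<lambda>U. U $ i) U"
proof (rule vec_differentiableI[where D = "\<lambda>j. if i = j then 1 else 0"])
  fix \<gamma> :: "real \<Rightarrow> real vec" and V t
  assume "\<And>i. i < n \<Longrightarrow> ((\<lambda>s. \<gamma> s $ i) has_real_derivative V i) (at t)"
  moreover have "(\<Sum>j<n. (if i = j then 1 else 0) * V j) = (\<Sum>j<n. if i = j then V j else 0)"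
    by (intro sum.cong) auto
  ultimately show "((\<lambda>s. \<gamma> s $ i) has_real_derivative (\<Sum>j<n. (if i = j then 1 else 0) * V j)) (at t)"
    using assms by simp
qed

lemma vec_differentiable_add:
  assumes "vec_differentiable n f U" "vec_differentiable n f' U"
  shows "vec_differentiable n (\<lambda>U. f U + f' U) U"
proof -
  obtain D where "has_gradient n f D U"
    using assms(1) by (auto simp: vec_differentiable_def)
  note D = has_gradientD[OF this]
  obtain E where "has_gradient n f' E U"
    using assms(2) by (auto simp: vec_differentiable_def)
  note E = has_gradientD[OF this]
  show ?thesis
  proof (rule vec_differentiableI[where D = "\<lambda>i. D i + E i"])
    fix \<gamma> :: "real \<Rightarrow> real vec" and V t
    assume *: "\<gamma> t = U" "\<And>i. i < n \<Longrightarrow> ((\<lambda>s. \<gamma> s $ i) has_real_derivative V i) (at t)"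
    show "((\<lambda>s. f (\<gamma> s) + f' (\<gamma> s)) has_real_derivative (\<Sum>i<n. (D i + E i) * V i)) (at t)"
      using DERIV_add[OF D[OF *] E[OF *]] by (simp add: distrib_right sum.distrib)
  qed
qed

lemma vec_differentiable_mult:
  assumes "vec_differentiable n f U" "vec_differentiable n f' U"
  shows "vec_differentiable n (\<lambda>U. f U * f' U) U"
proof -
  obtain D where "has_gradient n f D U"
    using assms(1) by (auto simp: vec_differentiable_def)
  note D = has_gradientD[OF this]
  obtain E where "has_gradient n f' E U"
    using assms(2) by (auto simp: vec_differentiable_def)
  note E = has_gradientD[OF this]
  show ?thesis
  proof (rule vec_differentiableI[where D = "\<lambda>i. D i * f' U + E i * f U"])
    fix \<gamma> :: "real \<Rightarrow> real vec" and V t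
    assume *: "\<gamma> t = U" "\<And>i. i < n \<Longrightarrow> ((\<lambda>s. \<gamma> s $ i) has_real_derivative V i) (at t)"
    show "((\<lambda>s. f (\<gamma> s) * f' (\<gamma> s)) has_real_derivative
        (\<Sum>i<n. (D i * f' U + E i * f U) * V i)) (at t)"
      using DERIV_mult[OF D[OF *] E[OF *]] *(1)
      by (simp add: sum_distrib_left sum_distrib_right sum.distrib algebra_simps)
  qed
qed

lemma vec_differentiable_inverse:
  assumes "vec_differentiable n f U" "f U \<noteq> 0"
  shows "vec_differentiable n (\<lambda>U. inverse (f U)) U"
proof -
  obtain D where "has_gradient n f D U"
    using assms(1) by (auto simp: vec_differentiable_def)
  note D = has_gradientD[OF this]
  show ?thesis
  proof (rule vec_differentiableI[where D = "\<lambda>i. - (inverse (f U) ^ 2) * D i"])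
    fix \<gamma> :: "real \<Rightarrow> real vec" and V t
    assume *: "\<gamma> t = U" "\<And>i. i < n \<Longrightarrow> ((\<lambda>s. \<gamma> s $ i) has_real_derivative V i) (at t)"
    show "((\<lambda>s. inverse (f (\<gamma> s))) has_real_derivative
        (\<Sum>i<n. - (inverse (f U) ^ 2) * D i * V i)) (at t)"
      using DERIV_inverse_fun[OF D[OF *]] *(1) assms(2)
      by (simp add: sum_distrib_left sum_negf mult_ac numeral_2_eq_2)
  qed
qed

lemma vec_differentiable_divide:
  assumes "vec_differentiable n f U" "vec_differentiable n f' U" "f' U \<noteq> 0"
  shows "vec_differentiable n (\<lambda>U. f U / f' U) U"
  unfolding divide_inverse
  using assms by (intro vec_differentiable_mult vec_differentiable_inverse)

lemma vec_differentiable_sum: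
  assumes "\<And>j. j \<in> J \<Longrightarrow> vec_differentiable n (f j) U"
  shows "vec_differentiable n (\<lambda>U. \<Sum>j\<in>J. f j U) U"
  using assms
  by (induction J rule: infinite_finite_induct)
     (simp_all add: vec_differentiable_const vec_differentiable_add)

text \<open>Inserting the coordinate lines through \<open>U\<close> as curves identifies the
  gradient with the partial derivatives that occur in \<open>jac\<close>.\<close>

lemma vec_differentiable_chain:
  assumes f: "vec_differentiable n f U" and U: "U \<in> carrier_vec n"
    and \<gamma>: "\<gamma> t = U" "\<And>i. i < n \<Longrightarrow> ((\<lambda>s. \<gamma> s $ i) has_real_derivative V i) (at t)"
  shows "((\<lambda>s. f (\<gamma> s)) has_real_derivative
    (\<Sum>i<n. deriv (\<lambda>x. f (update_vec U i x)) (U $ i) * V i)) (at t)"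
proof -
  obtain D where "has_gradient n f D U"
    using f by (auto simp: vec_differentiable_def)
  note D = has_gradientD[OF this]
  have "deriv (\<lambda>x. f (update_vec U c x)) (U $ c) = D c" if c: "c < n" for c
  proof -
    \<comment> \<open>The coordinate line in direction \<open>c\<close> has the \<open>c\<close>-th
      unit vector as its velocity, so the chain rule isolates \<open>D c\<close>.\<close>
    have "((\<lambda>x. f (update_vec U c x)) has_real_derivative (\<Sum>i<n. D i * of_bool (c = i))) (at (U $ c))"
    proof (rule D)
      show "update_vec U c (U $ c) = U" by (rule eq_vecI) (auto simp: update_vec_def)
      show "((\<lambda>x. update_vec U c x $ i) has_real_derivative of_bool (c = i)) (at (U $ c))"
        if "i < n" for i
        using that U by (auto simp: update_vec_def)
    qed
    also have "(\<Sum>i<n. D i * of_bool (c = i)) = (\<Sum>i<n. if c = i then D i else 0)"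
      by (intro sum.cong) auto
    finally show ?thesis using c by (simp add: DERIV_imp_deriv)
  qed
  then have "(\<Sum>i<n. deriv (\<lambda>x. f (update_vec U i x)) (U $ i) * V i) = (\<Sum>i<n. D i * V i)"
    by (intro sum.cong) auto
  then show ?thesis using D[OF \<gamma>] by simp
qed

section \<open>Jacobians under a linear change of variables\<close>

lemma jac_carrier:
  assumes "F U \<in> carrier_vec m" "U \<in> carrier_vec n"
  shows "jac F U \<in> carrier_mat m n"
  using assms by (simp add: jac_def carrier_matI)

text \<open>Both sides of \<open>eq\<close> are one and the same function along each coordinate line
  through \<open>U\<close>. Differentiating its component \<open>r\<close> in direction
  \<open>c\<close> by the chain rule at \<open>R U\<close>, and again term by term at
  \<open>U\<close>, gives entry \<open>(r, c)\<close> of the two matrix products; derivatives are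
  unique.\<close>

lemma jac_equivariant:
  fixes p q :: real
  assumes R: "R \<in> carrier_mat n n" and U: "U \<in> carrier_vec n"
    and F: "\<And>W. F W \<in> carrier_vec n" and G: "\<And>W. G W \<in> carrier_vec n"
    and dF: "\<And>r. r < n \<Longrightarrow> vec_differentiable n (\<lambda>W. F W $ r) U"
    and dG: "\<And>r. r < n \<Longrightarrow> vec_differentiable n (\<lambda>W. G W $ r) U"
    and dFR: "\<And>r. r < n \<Longrightarrow> vec_differentiable n (\<lambda>W. F W $ r) (R *\<^sub>v U)"
    and eq: "\<And>W. W \<in> carrier_vec n \<Longrightarrow> F (R *\<^sub>v W) = R *\<^sub>v (p \<cdot>\<^sub>v F W + q \<cdot>\<^sub>v G W)"
  shows "jac F (R *\<^sub>v U) * R = R * (p \<cdot>\<^sub>m jac F U + q \<cdot>\<^sub>m jac G U)"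
proof (rule eq_matI)
  have RU: "R *\<^sub>v U \<in> carrier_vec n" using R U by (rule mult_mat_vec_carrier)
  note J = jac_carrier[of F, OF F U] jac_carrier[of G, OF G U] jac_carrier[of F, OF F RU]
  fix r c
  assume "r < dim_row (R * (p \<cdot>\<^sub>m jac F U + q \<cdot>\<^sub>m jac G U))"
    "c < dim_col (R * (p \<cdot>\<^sub>m jac F U + q \<cdot>\<^sub>m jac G U))"
  then have r: "r < n" and c: "c < n" using R J by auto
  \<comment> \<open>\<open>\<delta>\<close> is the coordinate line through \<open>U\<close> in
    direction \<open>c\<close>. Its image under \<open>R\<close> has the \<open>c\<close>-th column
    of \<open>R\<close> as constant velocity, which is \<open>dR\<close> below.\<close>
  define \<delta> where "\<delta> = (\<lambda>x. update_vec U c x)"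
  have \<delta>: "\<delta> x \<in> carrier_vec n" for x
    using U by (auto simp: \<delta>_def update_vec_def)
  have \<delta>0: "\<delta> (U $ c) = U"
    unfolding \<delta>_def by (rule eq_vecI) (auto simp: update_vec_def)
  have d\<delta>: "((\<lambda>x. \<delta> x $ k) has_real_derivative of_bool (k = c)) (at t)" if "k < n" for k t
    using that U by (auto simp: \<delta>_def update_vec_def)
  have jac_index: "jac H W $$ (k, i) = deriv (\<lambda>x. H (update_vec W i x) $ k) (W $ i)"
    if "H W \<in> carrier_vec n" "W \<in> carrier_vec n" "k < n" "i < n" for H W k i
    using that by (simp add: jac_def)
  have mult_index: "(R *\<^sub>v W) $ i = (\<Sum>k<n. R $$ (i, k) * W $ k)"
    if "W \<in> carrier_vec n" "i < n" for W i
    using that R by (auto simp: scalar_prod_def atLeast0LessThan)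
  have dR: "((\<lambda>x. (R *\<^sub>v \<delta> x) $ i) has_real_derivative R $$ (i, c)) (at t)" if i: "i < n" for i t
  proof -
    have "((\<lambda>x. \<Sum>k<n. R $$ (i, k) * \<delta> x $ k) has_real_derivative
        (\<Sum>k<n. R $$ (i, k) * of_bool (k = c))) (at t)"
      by (intro DERIV_sum DERIV_cmult d\<delta>) auto
    also have "(\<Sum>k<n. R $$ (i, k) * of_bool (k = c)) = (\<Sum>k<n. if k = c then R $$ (i, k) else 0)"
      by (intro sum.cong) auto
    finally show ?thesis using c i by (simp add: mult_index[OF \<delta>])
  qed
  have partial: "((\<lambda>x. H (\<delta> x) $ k) has_real_derivative jac H U $$ (k, c)) (at (U $ c))"
    if H: "H U \<in> carrier_vec n" and dH: "vec_differentiable n (\<lambda>W. H W $ k) U" and k: "k < n" for H k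
  proof -
    have "((\<lambda>x. H (\<delta> x) $ k) has_real_derivative
        (\<Sum>i<n. deriv (\<lambda>x. H (update_vec U i x) $ k) (U $ i) * of_bool (i = c))) (at (U $ c))"
      by (rule vec_differentiable_chain[OF dH U]) (use \<delta>0 d\<delta> in auto)
    also have "(\<Sum>i<n. deriv (\<lambda>x. H (update_vec U i x) $ k) (U $ i) * of_bool (i = c))
        = (\<Sum>i<n. if i = c then jac H U $$ (k, i) else 0)"
      using H U k by (intro sum.cong) (auto simp: jac_index)
    finally show ?thesis using c by simp
  qed
  \<comment> \<open>First computation: the chain rule for \<open>F\<close> at \<open>R U\<close>,
    along the image of the line under \<open>R\<close>.\<close>
  have "((\<lambda>x. F (R *\<^sub>v \<delta> x) $ r) has_real_derivative
      (\<Sum>i<n. deriv (\<lambda>x. F (update_vec (R *\<^sub>v U) i x) $ r) ((R *\<^sub>v U) $ i) * R $$ (i, c))) (at (U $ c))"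
    by (rule vec_differentiable_chain[OF dFR[OF r] RU]) (use \<delta>0 dR in auto)
  also have "(\<Sum>i<n. deriv (\<lambda>x. F (update_vec (R *\<^sub>v U) i x) $ r) ((R *\<^sub>v U) $ i) * R $$ (i, c))
      = (jac F (R *\<^sub>v U) * R) $$ (r, c)"
    using r c R J RU F by (simp add: scalar_prod_def atLeast0LessThan jac_index)
  also have "(\<lambda>x. F (R *\<^sub>v \<delta> x) $ r)
      = (\<lambda>x. \<Sum>k<n. R $$ (r, k) * (p * F (\<delta> x) $ k + q * G (\<delta> x) $ k))"
  proof
    fix x
    have "p \<cdot>\<^sub>v F (\<delta> x) + q \<cdot>\<^sub>v G (\<delta> x) \<in> carrier_vec n"
      using F G by auto
    then show "F (R *\<^sub>v \<delta> x) $ r = (\<Sum>k<n. R $$ (r, k) * (p * F (\<delta> x) $ k + q * G (\<delta> x) $ k))"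
      using r carrier_vecD[OF F] carrier_vecD[OF G] by (simp add: eq[OF \<delta>] mult_index)
  qed
  finally have 1: "((\<lambda>x. \<Sum>k<n. R $$ (r, k) * (p * F (\<delta> x) $ k + q * G (\<delta> x) $ k))
      has_real_derivative (jac F (R *\<^sub>v U) * R) $$ (r, c)) (at (U $ c))" .
  \<comment> \<open>Second computation: the same function is a linear combination of components of
    \<open>F\<close> and \<open>G\<close> along the line itself, whose derivatives are the entries
    of their Jacobians at \<open>U\<close>.\<close>
  have "((\<lambda>x. \<Sum>k<n. R $$ (r, k) * (p * F (\<delta> x) $ k + q * G (\<delta> x) $ k))
      has_real_derivative (\<Sum>k<n. R $$ (r, k) * (p * jac F U $$ (k, c) + q * jac G U $$ (k, c))))
      (at (U $ c))"
    by (intro DERIV_sum DERIV_cmult DERIV_add partial F G dF dG) auto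
  also have "(\<Sum>k<n. R $$ (r, k) * (p * jac F U $$ (k, c) + q * jac G U $$ (k, c)))
      = (R * (p \<cdot>\<^sub>m jac F U + q \<cdot>\<^sub>m jac G U)) $$ (r, c)"
    using r c R J by (simp add: scalar_prod_def atLeast0LessThan)
  finally show "(jac F (R *\<^sub>v U) * R) $$ (r, c) = (R * (p \<cdot>\<^sub>m jac F U + q \<cdot>\<^sub>m jac G U)) $$ (r, c)"
    using 1 by (intro DERIV_unique)
qed (use R F U jac_carrier[of F, OF F U] jac_carrier[of G, OF G U]
       jac_carrier[of F, OF F mult_mat_vec_carrier[OF R U]] in auto)

section \<open>Rotational invariance of the fluxes\<close>

lemma flux_carrier:
  "flux_F g N U \<in> carrier_vec (2 * N + 3)" "flux_G g N U \<in> carrier_vec (2 * N + 3)"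
  by (simp_all add: flux_F_def flux_G_def)

text \<open>Squares of velocities and moments are written as products, so that all sums take the
  shape of the bilinear forms used in \<open>flux_rot\<close>.\<close>

lemma flux_F_index:
  "flux_F g N U $ 0 = ht U * um U"
  "flux_F g N U $ 1 = ht U * (um U * um U + (\<Sum>j=1..N. \<alpha> U j * \<alpha> U j / (2 * real j + 1)))
     + 1 / 2 * g * (ht U)\<^sup>2"
  "flux_F g N U $ 2 = ht U * (um U * vm U + (\<Sum>j=1..N. \<alpha> U j * \<beta> U j / (2 * real j + 1)))"
  "i \<in> {1..N} \<Longrightarrow> flux_F g N U $ (2 * i + 1) =
     ht U * (2 * um U * \<alpha> U i + (\<Sum>j=1..N. \<Sum>k=1..N. a i j k * \<alpha> U j * \<alpha> U k))"
  "i \<in> {1..N} \<Longrightarrow> flux_F g N U $ (2 * i + 2) =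
     ht U * (um U * \<beta> U i + vm U * \<alpha> U i + (\<Sum>j=1..N. \<Sum>k=1..N. a i j k * \<alpha> U j * \<beta> U k))"
  by (auto simp: flux_F_def power2_eq_square)

lemma flux_G_index:
  "flux_G g N U $ 0 = ht U * vm U"
  "flux_G g N U $ 1 = ht U * (um U * vm U + (\<Sum>j=1..N. \<alpha> U j * \<beta> U j / (2 * real j + 1)))"
  "flux_G g N U $ 2 = ht U * (vm U * vm U + (\<Sum>j=1..N. \<beta> U j * \<beta> U j / (2 * real j + 1)))
     + 1 / 2 * g * (ht U)\<^sup>2"
  "i \<in> {1..N} \<Longrightarrow> flux_G g N U $ (2 * i + 1) =
     ht U * (um U * \<beta> U i + vm U * \<alpha> U i + (\<Sum>j=1..N. \<Sum>k=1..N. a i j k * \<alpha> U j * \<beta> U k))"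
  "i \<in> {1..N} \<Longrightarrow> flux_G g N U $ (2 * i + 2) =
     ht U * (2 * vm U * \<beta> U i + (\<Sum>j=1..N. \<Sum>k=1..N. a i j k * \<beta> U j * \<beta> U k))"
  by (auto simp: flux_G_def power2_eq_square)

text \<open>The height is invariant, so division by it carries the rotation of the conserved pairs
  over to the velocities and moments.\<close>

lemma velocities_rot:
  assumes U: "U \<in> carrier_vec (2 * N + 3)"
  shows "ht (rot N \<theta> *\<^sub>v U) = ht U"
    "um (rot N \<theta> *\<^sub>v U) = cos \<theta> * um U + sin \<theta> * vm U"
    "vm (rot N \<theta> *\<^sub>v U) = - sin \<theta> * um U + cos \<theta> * vm U"
    "i \<le> N \<Longrightarrow> \<alpha> (rot N \<theta> *\<^sub>v U) i = cos \<theta> * \<alpha> U i + sin \<theta> * \<beta> U i"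
    "i \<le> N \<Longrightarrow> \<beta> (rot N \<theta> *\<^sub>v U) i = - sin \<theta> * \<alpha> U i + cos \<theta> * \<beta> U i"
proof -
  \<comment> \<open>Pair 0, with the indices \<open>2 * 0 + 1\<close> and \<open>2 * 0 + 2\<close>
    brought into the form in which \<open>um\<close> and \<open>vm\<close> use them.\<close>
  have r1: "(rot N \<theta> *\<^sub>v U) $ 1 = cos \<theta> * U $ 1 + sin \<theta> * U $ 2"
    and r2: "(rot N \<theta> *\<^sub>v U) $ 2 = - sin \<theta> * U $ 1 + cos \<theta> * U $ 2"
    using rot_mult_vec_index(2,3)[OF U le0, of \<theta>] by (simp_all only: mult_0_right add_0_left)
  note r = rot_mult_vec_index[OF U] r1 r2
  show "ht (rot N \<theta> *\<^sub>v U) = ht U" by (simp only: ht_def r)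
  show "um (rot N \<theta> *\<^sub>v U) = cos \<theta> * um U + sin \<theta> * vm U"
    "vm (rot N \<theta> *\<^sub>v U) = - sin \<theta> * um U + cos \<theta> * vm U"
    "i \<le> N \<Longrightarrow> \<alpha> (rot N \<theta> *\<^sub>v U) i = cos \<theta> * \<alpha> U i + sin \<theta> * \<beta> U i"
    "i \<le> N \<Longrightarrow> \<beta> (rot N \<theta> *\<^sub>v U) i = - sin \<theta> * \<alpha> U i + cos \<theta> * \<beta> U i"
    by (simp_all only: um_def vm_def \<alpha>_def \<beta>_def ht_def r add_divide_distrib times_divide_eq_right)
qed

lemma a_commute: "a i j k = a i k j"
  by (simp add: a_def mult_ac)

text \<open>Exchanging the two summation indices is harmless by \<open>a_commute\<close>. The mixed
  terms of an expanded quadratic sum therefore merge, as a symmetric tensor requires.\<close>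

lemma sum_a_commute:
  "(\<Sum>j=1..N. \<Sum>k=1..N. a i j k * y j * x k) = (\<Sum>j=1..N. \<Sum>k=1..N. a i j k * x j * y k)"
  by (subst sum.swap) (simp add: a_commute[of i] mult_ac)

text \<open>For each pair, the components of \<open>F\<close> and \<open>G\<close> form the two
  columns of a symmetric \<open>2 x 2\<close> tensor \<open>M\<close>, which becomes
  \<open>T2 M T2^T\<close> under rotation. The first column of \<open>T2^T\<close> is
  \<open>(cos \<theta>, sin \<theta>)\<close>, so the pair of \<open>F\<close> at the rotated state
  is \<open>T2\<close> applied to \<open>cos \<theta> F + sin \<theta> G\<close>.\<close>

lemma flux_rot:
  assumes U: "U \<in> carrier_vec (2 * N + 3)"
  shows "flux_F g N (rot N \<theta> *\<^sub>v U)
       = rot N \<theta> *\<^sub>v (cos \<theta> \<cdot>\<^sub>v flux_F g N U + sin \<theta> \<cdot>\<^sub>v flux_G g N U)" (is "_ = _ *\<^sub>v ?W")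
proof (rule eq_vecI)
  let ?n = "2 * N + 3" and ?RU = "rot N \<theta> *\<^sub>v U"
  have W: "?W \<in> carrier_vec ?n" using flux_carrier[of g N U] by auto
  fix r assume "r < dim_vec (rot N \<theta> *\<^sub>v ?W)"
  then have r: "r < ?n" using rot_carrier[of N \<theta>] by simp
  have W_index: "?W $ k = cos \<theta> * flux_F g N U $ k + sin \<theta> * flux_G g N U $ k" if "k < ?n" for k
    using that flux_carrier[of g N U] by simp
  have lt: "0 < ?n" "k \<le> N \<Longrightarrow> 2 * k + 1 < ?n" "k \<le> N \<Longrightarrow> 2 * k + 2 < ?n" for k
    by auto
  \<comment> \<open>\<open>S\<close> and \<open>Q i\<close> are the symmetric bilinear forms in the
    momentum rows and in the rows of moment \<open>i\<close>. Expanding them once by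
    \<open>S_lin\<close> and \<open>Q_lin\<close> keeps the trigonometric computation free of
    sums.\<close>
  define S where "S = (\<lambda>x y. \<Sum>j=1..N. x j * y j / (2 * real j + 1))"
  define Q where "Q = (\<lambda>i x y. \<Sum>j=1..N. \<Sum>k=1..N. a i j k * x j * y k)"
  have S_fold: "(\<Sum>j=1..N. x j * y j / (2 * real j + 1)) = S x y"
    and Q_fold: "(\<Sum>j=1..N. \<Sum>k=1..N. a i j k * x j * y k) = Q i x y" for i x y
    by (simp_all add: S_def Q_def)
  \<comment> \<open>The rotation formulas for the moments hold for indices up to \<open>N\<close>
    only, so the arguments of the forms are replaced pointwise on that range.\<close>
  have S_cong: "S x y = S x' y'" if "\<And>j. j \<le> N \<Longrightarrow> x j = x' j" "\<And>j. j \<le> N \<Longrightarrow> y j = y' j" for x y x' y'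
    unfolding S_def using that by (intro sum.cong) auto
  have Q_cong: "Q i x y = Q i x' y'" if "\<And>j. j \<le> N \<Longrightarrow> x j = x' j" "\<And>j. j \<le> N \<Longrightarrow> y j = y' j"
    for i x y x' y'
    unfolding Q_def using that by (intro sum.cong) auto
  have S_comm: "S y x = S x y" for x y
    by (simp add: S_def mult.commute)
  have Q_comm: "Q i y x = Q i x y" for i x y
    unfolding Q_def by (rule sum_a_commute)
  have S_lin: "S (\<lambda>j. p * x j + q * y j) (\<lambda>j. p' * x j + q' * y j)
      = p * p' * S x x + (p * q' + q * p') * S x y + q * q' * S y y" for p q p' q' x y
  proof -
    have "S (\<lambda>j. p * x j + q * y j) (\<lambda>j. p' * x j + q' * y j)
      = p * p' * S x x + p * q' * S x y + q * p' * S y x + q * q' * S y y"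
      unfolding S_def sum_distrib_left sum.distrib[symmetric]
      by (intro sum.cong refl) (simp add: algebra_simps add_divide_distrib)
    then show ?thesis by (simp add: S_comm[of y x] distrib_right)
  qed
  have Q_lin: "Q i (\<lambda>j. p * x j + q * y j) (\<lambda>j. p' * x j + q' * y j)
      = p * p' * Q i x x + (p * q' + q * p') * Q i x y + q * q' * Q i y y" for i p q p' q' x y
  proof -
    have "Q i (\<lambda>j. p * x j + q * y j) (\<lambda>j. p' * x j + q' * y j)
      = p * p' * Q i x x + p * q' * Q i x y + q * p' * Q i y x + q * q' * Q i y y"
      unfolding Q_def sum_distrib_left sum.distrib[symmetric]
      by (intro sum.cong refl) (simp add: algebra_simps)
    then show ?thesis by (simp add: Q_comm[of i y x] distrib_right)
  qed
  have \<alpha>\<beta>: "\<alpha> ?RU j = cos \<theta> * \<alpha> U j + sin \<theta> * \<beta> U j" "\<beta> ?RU j = - sin \<theta> * \<alpha> U j + cos \<theta> * \<beta> U j"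
    if "j \<le> N" for j
    using that by (simp_all only: velocities_rot[OF U])
  note S_rot = trans[OF S_cong S_lin, OF \<alpha>\<beta>(1) \<alpha>\<beta>(1)] trans[OF S_cong S_lin, OF \<alpha>\<beta>(1) \<alpha>\<beta>(2)]
  note Q_rot = trans[OF Q_cong Q_lin, OF \<alpha>\<beta>(1) \<alpha>\<beta>(1)] trans[OF Q_cong Q_lin, OF \<alpha>\<beta>(1) \<alpha>\<beta>(2)]
  note F = flux_F_index[where g = g and N = N, unfolded S_fold Q_fold]
    and G = flux_G_index[where g = g and N = N, unfolded S_fold Q_fold]
  note V = velocities_rot(1-3)[OF U]
  \<comment> \<open>The Pythagorean identity is oriented as an elimination of squared cosines;
    \<open>cs\<close> and \<open>cs'\<close> match the nested products left by
    \<open>algebra_simps\<close>.\<close>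
  have "cos \<theta> * cos \<theta> = 1 - sin \<theta> * sin \<theta>"
    using sin_cos_squared_add3[of \<theta>] by linarith
  then have cs: "cos \<theta> * (cos \<theta> * x) = x - sin \<theta> * (sin \<theta> * x)" for x
    by (simp add: left_diff_distrib flip: mult.assoc)
  then have cs': "x * (cos \<theta> * cos \<theta>) = x - x * (sin \<theta> * sin \<theta>)" for x
    by (metis mult.assoc mult.commute)
  show "flux_F g N ?RU $ r = (rot N \<theta> *\<^sub>v ?W) $ r"
    using r
  proof (cases rule: index_cases)
    case 1
    then show ?thesis
      by (simp only: rot_mult_vec_index[OF W] W_index lt F G V) (simp add: algebra_simps)
  next
    case (2 i)
    show ?thesis
    proof (cases "i = 0")
      case True
      \<comment> \<open>\<open>K\<close> is the hydrostatic pressure, which contributes a multiple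
        of the identity to the momentum tensor. It returns with the factor
        \<open>cos^2 + sin^2 = 1\<close>.\<close>
      define K where "K = 1 / 2 * g * (ht U)\<^sup>2"
      have W1: "(rot N \<theta> *\<^sub>v ?W) $ 1 = cos \<theta> * ?W $ 1 + sin \<theta> * ?W $ 2"
        using rot_mult_vec_index(2)[OF W le0, of \<theta>] by (simp only: mult_0_right add_0_left)
      have "1 < ?n" "2 < ?n" by auto
      then have "flux_F g N ?RU $ 1 = (rot N \<theta> *\<^sub>v ?W) $ 1"
        by (simp only: W1 W_index F G V S_rot K_def[symmetric]) (simp add: algebra_simps cs cs')
      then show ?thesis using True 2 by simp
    next
      case False
      then have i: "i \<in> {1..N}" using 2 by auto
      show ?thesis
        unfolding 2(2)
        by (simp only: rot_mult_vec_index(2,3)[OF W 2(1)] W_index lt(2,3)[OF 2(1)] F(4,5)[OF i] G(4,5)[OF i]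
              V Q_rot \<alpha>\<beta>[OF 2(1)])
           (simp add: algebra_simps)
    qed
  next
    case (3 i)
    show ?thesis
    proof (cases "i = 0")
      case True
      \<comment> \<open>In this row the two pressure terms have the factors
        \<open>- sin \<theta> * cos \<theta>\<close> and \<open>cos \<theta> * sin \<theta>\<close>
        and cancel.\<close>
      have W2: "(rot N \<theta> *\<^sub>v ?W) $ 2 = - sin \<theta> * ?W $ 1 + cos \<theta> * ?W $ 2"
        using rot_mult_vec_index(3)[OF W le0, of \<theta>] by (simp only: mult_0_right add_0_left)
      have "1 < ?n" "2 < ?n" by auto
      then have "flux_F g N ?RU $ 2 = (rot N \<theta> *\<^sub>v ?W) $ 2"
        by (simp only: W2 W_index F G V S_rot) (simp add: algebra_simps)
      then show ?thesis by (simp only: 3(2) True mult_0_right add_0_left)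
    next
      case False
      then have i: "i \<in> {1..N}" using 3 by auto
      show ?thesis
        unfolding 3(2)
        by (simp only: rot_mult_vec_index(2,3)[OF W 3(1)] W_index lt(2,3)[OF 3(1)] F(4,5)[OF i] G(4,5)[OF i]
              V Q_rot \<alpha>\<beta>[OF 3(1)])
           (simp add: algebra_simps)
    qed
  qed
qed (use rot_carrier[of N \<theta>] flux_carrier(1)[of g N "rot N \<theta> *\<^sub>v U"] in simp)

section \<open>Differentiability of the fluxes and invariance of their Jacobians\<close>

lemma vec_differentiable_velocities:
  assumes "U $ 0 \<noteq> 0"
  shows "vec_differentiable (2 * N + 3) ht U" "vec_differentiable (2 * N + 3) um U"
    "vec_differentiable (2 * N + 3) vm U"
    "i \<le> N \<Longrightarrow> vec_differentiable (2 * N + 3) (\<lambda>U. \<alpha> U i) U"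
    "i \<le> N \<Longrightarrow> vec_differentiable (2 * N + 3) (\<lambda>U. \<beta> U i) U"
  unfolding ht_def um_def vm_def \<alpha>_def \<beta>_def using assms
  by (auto intro!: vec_differentiable_index vec_differentiable_divide)

text \<open>Every component is a rational function of the entries of \<open>U\<close> whose only
  nonconstant denominators are powers of the height.\<close>

lemma vec_differentiable_flux:
  assumes U: "U $ 0 \<noteq> 0" and r: "r < 2 * N + 3"
  shows "vec_differentiable (2 * N + 3) (\<lambda>U. flux_F g N U $ r) U"
    "vec_differentiable (2 * N + 3) (\<lambda>U. flux_G g N U $ r) U"
proof -
  note d = vec_differentiable_add vec_differentiable_mult vec_differentiable_divide
    vec_differentiable_sum vec_differentiable_const vec_differentiable_velocities[OF U]
  have d1: "vec_differentiable (2 * N + 3) (\<lambda>U. flux_F g N U $ 1) U"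
    "vec_differentiable (2 * N + 3) (\<lambda>U. flux_G g N U $ 1) U"
    "vec_differentiable (2 * N + 3) (\<lambda>U. flux_F g N U $ 2) U"
    "vec_differentiable (2 * N + 3) (\<lambda>U. flux_G g N U $ 2) U"
    unfolding flux_F_index flux_G_index power2_eq_square by (intro d; simp)+
  have di: "vec_differentiable (2 * N + 3) (\<lambda>U. flux_F g N U $ (2 * i + 1)) U"
    "vec_differentiable (2 * N + 3) (\<lambda>U. flux_G g N U $ (2 * i + 1)) U"
    "vec_differentiable (2 * N + 3) (\<lambda>U. flux_F g N U $ (2 * i + 2)) U"
    "vec_differentiable (2 * N + 3) (\<lambda>U. flux_G g N U $ (2 * i + 2)) U"
    if "i \<in> {1..N}" for i
    unfolding flux_F_index(4,5)[OF that] flux_G_index(4,5)[OF that] using that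
    by (intro d; simp)+
  have "vec_differentiable (2 * N + 3) (\<lambda>U. flux_F g N U $ r) U \<and>
    vec_differentiable (2 * N + 3) (\<lambda>U. flux_G g N U $ r) U"
    using r
  proof (cases rule: index_cases)
    case 1
    then show ?thesis by (simp add: flux_F_index flux_G_index d)
  next
    case (2 i)
    then show ?thesis using d1 di[of i] by (cases "i = 0") auto
  next
    case (3 i)
    then show ?thesis using d1 di[of i] by (cases "i = 0") (simp_all flip: numeral_2_eq_2)
  qed
  then show "vec_differentiable (2 * N + 3) (\<lambda>U. flux_F g N U $ r) U"
    "vec_differentiable (2 * N + 3) (\<lambda>U. flux_G g N U $ r) U"
    by auto
qed

lemma jac_flux_rot:
  assumes U: "U \<in> carrier_vec (2 * N + 3)" and U0: "U $ 0 \<noteq> 0"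
  shows "rot N (- \<theta>) * jac (flux_F g N) (rot N \<theta> *\<^sub>v U) * rot N \<theta>
       = cos \<theta> \<cdot>\<^sub>m jac (flux_F g N) U + sin \<theta> \<cdot>\<^sub>m jac (flux_G g N) U" (is "_ * ?J * _ = ?K")
proof -
  let ?n = "2 * N + 3" and ?RU = "rot N \<theta> *\<^sub>v U"
  have RU: "?RU \<in> carrier_vec ?n" "?RU $ 0 \<noteq> 0"
    using U U0 rot_mult_vec_carrier by (simp_all add: rot_mult_vec_index(1))
  have J: "?J \<in> carrier_mat ?n ?n" and K: "?K \<in> carrier_mat ?n ?n"
    using jac_carrier[of "flux_F g N", OF flux_carrier(1) U] RU
      jac_carrier[of "flux_G g N", OF flux_carrier(2) U] jac_carrier[of "flux_F g N", OF flux_carrier(1)]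
    by auto
  have "?J * rot N \<theta> = rot N \<theta> * ?K"
    by (rule jac_equivariant[OF rot_carrier U flux_carrier])
       (use U0 RU in \<open>auto intro: vec_differentiable_flux flux_rot\<close>)
  \<comment> \<open>Multiplication by \<open>rot N (- \<theta>)\<close> from the left turns the
    intertwining relation into a conjugation.\<close>
  then have "rot N (- \<theta>) * ?J * rot N \<theta> = rot N (- \<theta>) * rot N \<theta> * ?K"
    by (simp only: assoc_mult_mat[OF rot_carrier J rot_carrier]
        assoc_mult_mat[OF rot_carrier rot_carrier K])
  then show ?thesis by (simp only: rot_inverse left_mult_one_mat[OF K])
qed

section \<open>The invariance of the HSWME system\<close>

lemma truncate_state_carrier: "truncate_state N U \<in> carrier_vec (2 * N + 3)"
  by (simp add: truncate_state_def)

text \<open>The five retained entries are the height and the complete pairs 0 and 1. No pair is cut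
  in two, and a rotated zero pair is zero.\<close>

lemma truncate_state_rot:
  assumes U: "U \<in> carrier_vec (2 * N + 3)"
  shows "truncate_state N (rot N \<theta> *\<^sub>v U) = rot N \<theta> *\<^sub>v truncate_state N U"
proof (rule eq_vecI)
  fix r assume "r < dim_vec (rot N \<theta> *\<^sub>v truncate_state N U)"
  then have r: "r < 2 * N + 3" using rot_carrier[of N \<theta>] by simp
  have idx: "truncate_state N W $ k = (if k < 5 then W $ k else 0)" if "k < 2 * N + 3" for W k
    using that by (simp add: truncate_state_def)
  have lt: "0 < 2 * N + 3" "k \<le> N \<Longrightarrow> 2 * k + 1 < 2 * N + 3" "k \<le> N \<Longrightarrow> 2 * k + 2 < 2 * N + 3"
    "(2 * k + 1 < 5) = (k < 2)" "(2 * k + 2 < 5) = (k < 2)" "(0::nat) < 5" for k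
    by auto
  note eqs = rot_mult_vec_index[OF truncate_state_carrier] rot_mult_vec_index[OF U] idx lt
  show "truncate_state N (rot N \<theta> *\<^sub>v U) $ r = (rot N \<theta> *\<^sub>v truncate_state N U) $ r"
    using r
  proof (cases rule: index_cases)
    case 1
    then show ?thesis by (simp only: eqs if_True)
  next
    case (2 i)
    then show ?thesis by (simp only: eqs) (cases "i < 2"; simp)
  next
    case (3 i)
    then show ?thesis by (simp only: eqs) (cases "i < 2"; simp)
  qed
qed (use rot_carrier[of N \<theta>] in \<open>simp add: truncate_state_def\<close>)

section \<open>The nonconservative terms and blockwise invariance\<close>

lemma PQ_block_carrier:
  "P_block N U i j \<in> carrier_mat 2 2" "Q_block N U i j \<in> carrier_mat 2 2"
  by (simp_all add: P_block_def Q_block_def mat_of_rows_list_def carrier_matI)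

lemma rot2_P_block:
  assumes U: "U \<in> carrier_vec (2 * N + 3)"
  shows "rot2 (- \<theta>) * P_block N (rot N \<theta> *\<^sub>v U) i j * rot2 \<theta>
       = cos \<theta> \<cdot>\<^sub>m P_block N U i j + sin \<theta> \<cdot>\<^sub>m Q_block N U i j"
proof -
  let ?RU = "rot N \<theta> *\<^sub>v U"
  define S where "S = (\<lambda>x. \<Sum>k=1..N. b i j k * x k)"
  \<comment> \<open>\<open>(p, q)\<close> is a combination of the vectors \<open>(um, vm)\<close>
    and \<open>(\<alpha> k, \<beta> k)\<close> with the same coefficients in both components, so it
    rotates like a velocity.\<close>
  define p where "p = (\<lambda>W. - of_bool (i = j) * um W + S (\<alpha> W))"
  define q where "q = (\<lambda>W. - of_bool (i = j) * vm W + S (\<beta> W))"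
  have PQ: "P_block N W i j $$ (0, 0) = p W" "P_block N W i j $$ (1, 0) = q W"
    "P_block N W i j $$ (0, 1) = 0" "P_block N W i j $$ (1, 1) = 0"
    "Q_block N W i j $$ (0, 0) = 0" "Q_block N W i j $$ (1, 0) = 0"
    "Q_block N W i j $$ (0, 1) = p W" "Q_block N W i j $$ (1, 1) = q W" for W
    by (simp_all add: P_block_def Q_block_def p_def q_def S_def mat_of_rows_list_def)
  have "S (\<alpha> ?RU) = cos \<theta> * S (\<alpha> U) + sin \<theta> * S (\<beta> U)"
    "S (\<beta> ?RU) = - sin \<theta> * S (\<alpha> U) + cos \<theta> * S (\<beta> U)"
    unfolding S_def sum_distrib_left sum.distrib[symmetric]
    by (intro sum.cong refl, simp add: velocities_rot[OF U] algebra_simps)+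
  then have p: "p ?RU = cos \<theta> * p U + sin \<theta> * q U" and q: "q ?RU = cos \<theta> * q U - sin \<theta> * p U"
    by (simp_all add: p_def q_def velocities_rot[OF U] algebra_simps)
  have "cos \<theta> * cos \<theta> = 1 - sin \<theta> * sin \<theta>"
    using sin_cos_squared_add3[of \<theta>] by linarith
  then have cs: "cos \<theta> * (cos \<theta> * x) = x - sin \<theta> * (sin \<theta> * x)" for x
    by (simp add: left_diff_distrib flip: mult.assoc)
  \<comment> \<open>The left factor \<open>rot2 (- \<theta>)\<close> rotates the column at the new
    state back to the column at \<open>U\<close>; the right factor then distributes it over
    \<open>P\<close> and \<open>Q\<close>.\<close>
  have unrot: "cos \<theta> * p ?RU - sin \<theta> * q ?RU = p U" "sin \<theta> * p ?RU + cos \<theta> * q ?RU = q U"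
    unfolding p q by (simp_all add: algebra_simps cs)
  show ?thesis
  proof (rule eq_matI)
    fix r k
    assume "r < dim_row (cos \<theta> \<cdot>\<^sub>m P_block N U i j + sin \<theta> \<cdot>\<^sub>m Q_block N U i j)"
      "k < dim_col (cos \<theta> \<cdot>\<^sub>m P_block N U i j + sin \<theta> \<cdot>\<^sub>m Q_block N U i j)"
    then have rk: "r < 2" "k < 2" by (auto simp: carrier_matD[OF PQ_block_carrier(2)])
    then have "(cos \<theta> \<cdot>\<^sub>m P_block N U i j + sin \<theta> \<cdot>\<^sub>m Q_block N U i j) $$ (r, k)
        = cos \<theta> * P_block N U i j $$ (r, k) + sin \<theta> * Q_block N U i j $$ (r, k)"
      by (simp add: carrier_matD[OF PQ_block_carrier(1)] carrier_matD[OF PQ_block_carrier(2)])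
    moreover have "r = 0 \<or> r = 1" "k = 0 \<or> k = 1" using rk by auto
    ultimately show "(rot2 (- \<theta>) * P_block N ?RU i j * rot2 \<theta>) $$ (r, k)
        = (cos \<theta> \<cdot>\<^sub>m P_block N U i j + sin \<theta> \<cdot>\<^sub>m Q_block N U i j) $$ (r, k)"
      by (elim disjE; simp only: rot2_conj_index[OF PQ_block_carrier(1)] PQ unrot) simp_all
  qed (simp_all add: carrier_matD[OF PQ_block_carrier(2)])
qed

text \<open>A zero border of width three is a border of width one followed by a zero block row and
  column for the mean velocity. In this form it fits the block partition of
  \<open>rot\<close>.\<close>

lemma bordered_3_eq:
  "bordered 3 N M = bordered 1 (N + 1) (\<lambda>i j. if i = 1 \<or> j = 1 then 0\<^sub>m 2 2 else M (i - 1) (j - 1))"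
  (is "_ = ?R")
proof (rule eq_matI)
  fix r c assume "r < dim_row ?R" "c < dim_col ?R"
  then have rc: "r < 2 * N + 3" "c < 2 * N + 3" by (auto simp: bordered_dim)
  \<comment> \<open>Counting from 1 instead of 3 raises the block number by one and keeps the
    position inside the block.\<close>
  have shift: "(k - 1) div 2 = Suc ((k - 3) div 2)" "(k - 1) mod 2 = (k - 3) mod 2"
    if "\<not> k < 3" for k :: nat
  proof -
    obtain l where "k = l + 3" using \<open>\<not> k < 3\<close> by (metis le_iff_add linorder_not_less add.commute)
    then show "(k - 1) div 2 = Suc ((k - 3) div 2)" "(k - 1) mod 2 = (k - 3) mod 2" by auto
  qed
  have small: "(k - 1) div 2 = 0" if "k < 3" for k :: nat
    using that by auto
  show "bordered 3 N M $$ (r, c) = ?R $$ (r, c)"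
    using rc by (cases "r < 3"; cases "c < 3") (auto simp: bordered_index shift small simp del: One_nat_def)
qed (simp_all add: bordered_dim)

text \<open>Conjugation and linear combination both act blockwise. This one reduction serves the
  nonconservative terms as well as the added blocks \<open>Ablk\<close> and
  \<open>Bblk\<close>.\<close>

lemma bordered_rot:
  assumes M: "\<And>i j. i \<in> {1..N+1} \<Longrightarrow> j \<in> {1..N+1} \<Longrightarrow>
      M i j \<in> carrier_mat 2 2 \<and> X i j \<in> carrier_mat 2 2 \<and> Y i j \<in> carrier_mat 2 2 \<and>
      rot2 (- \<theta>) * M i j * rot2 \<theta> = cos \<theta> \<cdot>\<^sub>m X i j + sin \<theta> \<cdot>\<^sub>m Y i j"
  shows "rot N (- \<theta>) * bordered 1 (N + 1) M * rot N \<theta>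
       = cos \<theta> \<cdot>\<^sub>m bordered 1 (N + 1) X + sin \<theta> \<cdot>\<^sub>m bordered 1 (N + 1) Y"
proof -
  have "rot N (- \<theta>) * bordered 1 (N + 1) M * rot N \<theta>
       = bordered 1 (N + 1) (\<lambda>i j. rot2 (- \<theta>) * M i j * rot2 \<theta>)"
    using M by (intro bordered_rot_conj) blast
  also have "\<dots> = cos \<theta> \<cdot>\<^sub>m bordered 1 (N + 1) X + sin \<theta> \<cdot>\<^sub>m bordered 1 (N + 1) Y" (is "?L = ?R")
  proof (rule eq_matI)
    fix r c assume "r < dim_row ?R" "c < dim_col ?R"
    then have rc: "r < 1 + 2 * (N + 1)" "c < 1 + 2 * (N + 1)" by (auto simp: bordered_dim)
    let ?i = "(r - 1) div 2 + 1" and ?j = "(c - 1) div 2 + 1"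
    have "?i \<in> {1..N+1}" "?j \<in> {1..N+1}" using rc by auto
    note M = M[OF this]
    show "?L $$ (r, c) = ?R $$ (r, c)"
    proof (cases "r < 1 \<or> c < 1")
      case True
      then show ?thesis using rc by (simp add: bordered_index bordered_dim)
    next
      case False
      have "?L $$ (r, c) = (rot2 (- \<theta>) * M ?i ?j * rot2 \<theta>) $$ ((r - 1) mod 2, (c - 1) mod 2)"
        using False by (simp only: bordered_index[OF rc] if_False)
      also have "\<dots> = (cos \<theta> \<cdot>\<^sub>m X ?i ?j + sin \<theta> \<cdot>\<^sub>m Y ?i ?j) $$ ((r - 1) mod 2, (c - 1) mod 2)"
        using M by simp
      also have "\<dots> = cos \<theta> * X ?i ?j $$ ((r - 1) mod 2, (c - 1) mod 2)
          + sin \<theta> * Y ?i ?j $$ ((r - 1) mod 2, (c - 1) mod 2)"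
        using M by (auto simp: carrier_matD)
      also have "\<dots> = ?R $$ (r, c)"
        using rc False by (simp add: bordered_dim bordered_index)
      finally show ?thesis .
    qed
  qed (simp_all add: bordered_dim)
  finally show ?thesis .
qed

text \<open>Conjugation is additive, so the Jacobian, the nonconservative part and the added blocks
  can be treated separately.\<close>

lemma rot_conj_add:
  assumes c: "X \<in> carrier_mat (2 * N + 3) (2 * N + 3)" "X' \<in> carrier_mat (2 * N + 3) (2 * N + 3)"
    "Y \<in> carrier_mat (2 * N + 3) (2 * N + 3)" "Y' \<in> carrier_mat (2 * N + 3) (2 * N + 3)"
    "Z \<in> carrier_mat (2 * N + 3) (2 * N + 3)" "Z' \<in> carrier_mat (2 * N + 3) (2 * N + 3)"
    and X: "rot N (- \<theta>) * X * rot N \<theta> = p \<cdot>\<^sub>m Y + q \<cdot>\<^sub>m Z"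
    and X': "rot N (- \<theta>) * X' * rot N \<theta> = p \<cdot>\<^sub>m Y' + q \<cdot>\<^sub>m Z'"
  shows "rot N (- \<theta>) * (X + X') * rot N \<theta> = p \<cdot>\<^sub>m (Y + Y') + q \<cdot>\<^sub>m (Z + Z')"
proof -
  have "rot N (- \<theta>) * (X + X') * rot N \<theta> = rot N (- \<theta>) * X * rot N \<theta> + rot N (- \<theta>) * X' * rot N \<theta>"
    using c rot_carrier[of N \<theta>] rot_carrier[of N "- \<theta>"]
    by (simp add: mult_add_distrib_mat[of _ "2 * N + 3" "2 * N + 3"]
        add_mult_distrib_mat[of _ "2 * N + 3" "2 * N + 3"])
  also have "\<dots> = p \<cdot>\<^sub>m (Y + Y') + q \<cdot>\<^sub>m (Z + Z')"
    unfolding X X' by (rule eq_matI) (use c in \<open>auto simp: distrib_left\<close>)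
  finally show ?thesis .
qed

lemma bordered_carrier_rot:
  "bordered 1 (N + 1) M \<in> carrier_mat (2 * N + 3) (2 * N + 3)"
  "bordered 3 N M \<in> carrier_mat (2 * N + 3) (2 * N + 3)"
  by (simp_all add: bordered_dim carrier_matI)

lemma SW_carrier:
  assumes "U \<in> carrier_vec (2 * N + 3)"
  shows "A_SW g N U \<in> carrier_mat (2 * N + 3) (2 * N + 3)"
    "B_SW g N U \<in> carrier_mat (2 * N + 3) (2 * N + 3)"
  unfolding A_SW_def B_SW_def
  using jac_carrier[of "flux_F g N", OF flux_carrier(1) assms]
    jac_carrier[of "flux_G g N", OF flux_carrier(2) assms] bordered_carrier_rot
  by auto

lemma SW_rot:
  assumes U: "U \<in> carrier_vec (2 * N + 3)" and U0: "U $ 0 \<noteq> 0"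
  shows "rot N (- \<theta>) * A_SW g N (rot N \<theta> *\<^sub>v U) * rot N \<theta>
       = cos \<theta> \<cdot>\<^sub>m A_SW g N U + sin \<theta> \<cdot>\<^sub>m B_SW g N U"
proof -
  have RU: "rot N \<theta> *\<^sub>v U \<in> carrier_vec (2 * N + 3)" using U by (rule rot_mult_vec_carrier)
  \<comment> \<open>Covers the zero blocks of the mean velocity that \<open>bordered_3_eq\<close>
    inserts.\<close>
  have zero: "rot2 (- \<theta>) * 0\<^sub>m 2 2 * rot2 \<theta> = cos \<theta> \<cdot>\<^sub>m 0\<^sub>m 2 2 + sin \<theta> \<cdot>\<^sub>m 0\<^sub>m 2 2"
    using rot2_carrier[of \<theta>] rot2_carrier[of "- \<theta>"] by simp
  have "rot N (- \<theta>) * bordered 3 N (P_block N (rot N \<theta> *\<^sub>v U)) * rot N \<theta>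
     = cos \<theta> \<cdot>\<^sub>m bordered 3 N (P_block N U) + sin \<theta> \<cdot>\<^sub>m bordered 3 N (Q_block N U)"
    unfolding bordered_3_eq
    by (rule bordered_rot) (auto simp: PQ_block_carrier rot2_P_block[OF U] zero)
  then show ?thesis
    unfolding A_SW_def B_SW_def
    by (intro rot_conj_add jac_flux_rot U U0 jac_carrier flux_carrier RU bordered_carrier_rot)
qed

text \<open>Truncation commutes with the rotation and keeps the height, so this is the invariance of
  the full system at the truncated state.\<close>

lemma H_rot:
  assumes U: "U \<in> carrier_vec (2 * N + 3)" and U0: "U $ 0 \<noteq> 0"
  shows "rot N (- \<theta>) * A_H g N (rot N \<theta> *\<^sub>v U) * rot N \<theta>
       = cos \<theta> \<cdot>\<^sub>m A_H g N U + sin \<theta> \<cdot>\<^sub>m B_H g N U"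
  unfolding A_H_def B_H_def truncate_state_rot[OF U]
  using U0 by (intro SW_rot truncate_state_carrier) (simp add: truncate_state_def)

theorem theorem3p4:
  fixes N :: nat and g :: real
    and Ablk Bblk :: "nat \<Rightarrow> nat \<Rightarrow> real vec \<Rightarrow> real mat"
    and A B :: "real vec \<Rightarrow> real mat"
  assumes "N \<ge> 1" and "g > 0"
    and "\<And>i j U. i \<in> {1..N+1} \<Longrightarrow> j \<in> {1..N+1} \<Longrightarrow> U \<in> states N \<Longrightarrow>
           Ablk i j U \<in> carrier_mat 2 2 \<and> Bblk i j U \<in> carrier_mat 2 2"
    and "\<And>i j \<theta> U. i \<in> {1..N+1} \<Longrightarrow> j \<in> {1..N+1} \<Longrightarrow> 0 \<le> \<theta> \<Longrightarrow> \<theta> < 2 * pi \<Longrightarrow> U \<in> states N \<Longrightarrow>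
           minv (rot2 \<theta>) * Ablk i j (rot N \<theta> *\<^sub>v U) * rot2 \<theta>
             = cos \<theta> \<cdot>\<^sub>m Ablk i j U + sin \<theta> \<cdot>\<^sub>m Bblk i j U"
    and "\<And>U. U \<in> states N \<Longrightarrow> A U = A_H g N U + bordered 1 (N + 1) (\<lambda>i j. Ablk i j U)"
    and "\<And>U. U \<in> states N \<Longrightarrow> B U = B_H g N U + bordered 1 (N + 1) (\<lambda>i j. Bblk i j U)"
  shows "\<forall>\<theta> U. 0 \<le> \<theta> \<and> \<theta> < 2 * pi \<and> U \<in> states N \<longrightarrow>
           cos \<theta> \<cdot>\<^sub>m A U + sin \<theta> \<cdot>\<^sub>m B U
             = minv (rot N \<theta>) * A (rot N \<theta> *\<^sub>v U) * rot N \<theta>"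
proof (intro allI impI)
  fix \<theta> :: real and U :: "real vec"
  assume *: "0 \<le> \<theta> \<and> \<theta> < 2 * pi \<and> U \<in> states N"
  then have U: "U \<in> carrier_vec (2 * N + 3)" and U0: "U $ 0 > 0"
    by (auto simp: states_def)
  let ?RU = "rot N \<theta> *\<^sub>v U"
  \<comment> \<open>The rotation fixes the height, so the assumptions on \<open>A\<close> and on the
    blocks also apply at the rotated state.\<close>
  have RU: "?RU \<in> states N"
    using U U0 rot_mult_vec_carrier[OF U] by (simp add: states_def rot_mult_vec_index(1))
  have "rot N (- \<theta>) * bordered 1 (N + 1) (\<lambda>i j. Ablk i j ?RU) * rot N \<theta>
      = cos \<theta> \<cdot>\<^sub>m bordered 1 (N + 1) (\<lambda>i j. Ablk i j U)
        + sin \<theta> \<cdot>\<^sub>m bordered 1 (N + 1) (\<lambda>i j. Bblk i j U)"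
    using * RU assms(3,4) by (intro bordered_rot) (simp add: minv_rot2)
  then have "rot N (- \<theta>) * (A_H g N ?RU + bordered 1 (N + 1) (\<lambda>i j. Ablk i j ?RU)) * rot N \<theta>
      = cos \<theta> \<cdot>\<^sub>m (A_H g N U + bordered 1 (N + 1) (\<lambda>i j. Ablk i j U))
        + sin \<theta> \<cdot>\<^sub>m (B_H g N U + bordered 1 (N + 1) (\<lambda>i j. Bblk i j U))"
    using U0
    by (intro rot_conj_add H_rot U bordered_carrier_rot)
       (simp_all add: A_H_def B_H_def SW_carrier truncate_state_carrier)
  then show "cos \<theta> \<cdot>\<^sub>m A U + sin \<theta> \<cdot>\<^sub>m B U = minv (rot N \<theta>) * A ?RU * rot N \<theta>"
    using * RU assms(5,6) by (simp add: minv_rot)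
qed

end
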